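(* Let $n\ge2$ and $\sigma^2>0$ be fixed, and suppose $X_i\sim\mathcal N(\mu_i^\star,\sigma^2)$ independently for $i=1,\dots,n$. Let $\mathcal S$ be any linear knowledge partition of $\mathbb{R}^n$ cut by $(n-1)$-dimensional affine hyperplanes $H_1,\dots,H_K$. If $\mathcal S$ is truthful (for this normal model), then for each $1\le k\le K$ there exist indices $1\le i_k<j_k\le n$ such that $$H_k=\{\boldsymbol x\in\mathbb{R}^n:\ x_{i_k}-x_{j_k}=0\}.$$
   Context: Knowledge partition: a collection $\mathcal S$ of pairwise disjoint subsets of $\mathbb{R}^n$ whose union is $\mathbb{R}^n$; its members are called knowledge elements. It is linear, cut by the hyperplanes $H_1,\dots,H_K$ (finitely many, distinct), if its elements are the regions enclosed by these hyperplanes with no hyperplane passing through the interior of any element; that is, each $S\in\mathcal S$ satisfies $C\subseteq S\subseteq\overline{C}$ for a connected component $C$ of $\mathbb{R}^n\setminus\bigcup_k H_k$ (with every component arising in this way). Mechanism: given $\boldsymbol X=(X_1,\dots,X_n)$ with mean vector $\boldsymbol\mu^\star$ and a reported element $S\in\mathcal S$, let $\widehat{\boldsymbol\mu}^S$ be the Euclidean projection of $\boldsymbol X$ onto $S$ (i.e. the minimizer of $\sum_i(X_i-\mu_i)^2$ over $\boldsymbol\mu\in\overline S$). For nondecreasing convex $U:\mathbb{R}\to\mathbb{R}$ let $\mathsf{Util}(S)=\mathbb{E}\big[\sum_{i=1}^nU(\widehat\mu^S_i)\big]\in(-\infty,+\infty]$. Truthful: $\mathcal S$ is truthful if for every $\boldsymbol\mu^\star\in\mathbb{R}^n$,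 for every nondecreasing convex $U:\mathbb{R}\to\mathbb{R}$, and for the unique $S^\star\in\mathcal S$ containing $\boldsymbol\mu^\star$, one has $\mathsf{Util}(S^\star)\ge\mathsf{Util}(S)$ for every $S\in\mathcal S$ (with $\sigma^2$ held fixed). *)

theory Defs
  imports "HOL-Probability.Probability"
begin

definition knowledge_partition :: "(real ^ 'n) set set \<Rightarrow> bool" where
  "knowledge_partition \<S> \<longleftrightarrow> disjoint \<S> \<and> \<Union>\<S> = UNIV"

definition affine_hyperplane :: "(real ^ 'n) set \<Rightarrow> bool" where
  "affine_hyperplane H \<longleftrightarrow> (\<exists>a b. a \<noteq> 0 \<and> H = {x. a \<bullet> x = b})"

text \<open>
  The cutting hyperplanes are \<open>H 1, \<dots>, H K\<close>; values of \<open>H\<close> outside \<open>{1..K}\<close> are irrelevant.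
  Which of the adjacent elements a boundary point belongs to is left open.
\<close>

definition linear_knowledge_partition ::
    "(real ^ 'n) set set \<Rightarrow> nat \<Rightarrow> (nat \<Rightarrow> (real ^ 'n) set) \<Rightarrow> bool" where
  "linear_knowledge_partition \<S> K H \<longleftrightarrow>
     knowledge_partition \<S> \<and>
     (\<forall>k\<in>{1..K}. affine_hyperplane (H k)) \<and>
     inj_on H {1..K} \<and>
     (\<forall>S\<in>\<S>. \<exists>C\<in>components (UNIV - (\<Union>k\<in>{1..K}. H k)). C \<subseteq> S \<and> S \<subseteq> closure C) \<and>
     (\<forall>C\<in>components (UNIV - (\<Union>k\<in>{1..K}. H k)). \<exists>S\<in>\<S>. C \<subseteq> S \<and> S \<subseteq> closure C)"

text \<open>
  Extended-real expectation \<open>E[f\<^sup>+] - E[f\<^sup>-]\<close>. Unlike the Bochner integral, which is \<open>0\<close> on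
  non-integrable functions, it is \<open>\<infinity>\<close> when \<open>E[f\<^sup>+] = \<infinity>\<close> and \<open>E[f\<^sup>-] < \<infinity>\<close>.
  In the use below the negative part has finite expectation: a nondecreasing convex function is
  bounded below by an affine one, and projection onto a closed convex set is nonexpansive.
\<close>

definition ext_expectation :: "'w measure \<Rightarrow> ('w \<Rightarrow> real) \<Rightarrow> ereal" where
  "ext_expectation M f =
     enn2ereal (\<integral>\<^sup>+ \<omega>. ennreal (f \<omega>) \<partial>M) - enn2ereal (\<integral>\<^sup>+ \<omega>. ennreal (- f \<omega>) \<partial>M)"

definition mechanism :: "('w \<Rightarrow> real ^ 'n) \<Rightarrow> (real ^ 'n) set \<Rightarrow> 'w \<Rightarrow> real ^ 'n" where
  "mechanism X S \<omega> = closest_point (closure S) (X \<omega>)"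

definition Util ::
    "'w measure \<Rightarrow> ('w \<Rightarrow> real ^ 'n) \<Rightarrow> (real \<Rightarrow> real) \<Rightarrow> (real ^ 'n) set \<Rightarrow> ereal" where
  "Util M X U S = ext_expectation M (\<lambda>\<omega>. \<Sum>i\<in>UNIV. U (mechanism X S \<omega> $ i))"

text \<open>The parameter \<open>\<sigma>\<close> is the standard deviation, as in \<^const>\<open>normal_density\<close>.\<close>

definition normal_model ::
    "real \<Rightarrow> real ^ 'n \<Rightarrow> 'w measure \<Rightarrow> ('w \<Rightarrow> real ^ 'n) \<Rightarrow> bool" where
  "normal_model \<sigma> \<mu> M X \<longleftrightarrow>
     prob_space M \<and>
     prob_space.indep_vars M (\<lambda>_. borel) (\<lambda>i \<omega>. X \<omega> $ i) UNIV \<and>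
     (\<forall>i. distributed M lborel (\<lambda>\<omega>. X \<omega> $ i) (\<lambda>x. ennreal (normal_density (\<mu> $ i) \<sigma> x)))"

text \<open>
  Truthfulness compares utilities for every possible true mean, so it refers to a statistical
  model, i.e. a family of probability spaces \<open>M \<mu>\<close> and random vectors \<open>X \<mu>\<close> indexed by the mean
  vector \<open>\<mu>\<close>.
\<close>

definition truthful ::
    "(real ^ 'n \<Rightarrow> 'w measure) \<Rightarrow> (real ^ 'n \<Rightarrow> 'w \<Rightarrow> real ^ 'n) \<Rightarrow> (real ^ 'n) set set \<Rightarrow> bool" where
  "truthful M X \<S> \<longleftrightarrow>
     (\<forall>\<mu> U. mono U \<longrightarrow> convex_on UNIV U \<longrightarrow>
        (\<forall>S\<^sub>0\<in>\<S>. \<mu> \<in> S\<^sub>0 \<longrightarrow> (\<forall>S\<in>\<S>. Util (M \<mu>) (X \<mu>) U S\<^sub>0 \<ge> Util (M \<mu>) (X \<mu>) U S)))"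

end

theory Submission
  imports Defs
begin

text \<open>
  Fix a cutting hyperplane with normal \<open>\<nu>\<close> and move the mean to infinity along it, in a generic
  direction \<open>v\<close>, staying at vanishing distance on one side or the other. All hyperplanes that are
  not parallel recede, so in the limit the two adjacent elements look like slabs orthogonal to
  \<open>\<nu>\<close>, and truthfulness on either side, applied to the hinge functions
  \<open>U\<^sub>n x = max 0 (x - n * c)\<close>, passes to the limit by dominated convergence. Coordinates with
  \<open>v $ i < c\<close> then contribute nothing, and those with \<open>v $ i > c\<close> contribute linearly.

  If \<open>\<nu>\<close> is not a multiple of a difference of two unit vectors, \<open>v\<close> can be chosen with pairwise
  distinct coordinates. The two sides force the sum of the \<open>\<nu> $ i\<close> with \<open>v $ i > c\<close> to vanish for
  all \<open>c\<close> off the coordinates of \<open>v\<close>, so \<open>\<nu> = 0\<close>.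

  If the hyperplane is \<open>x $ i - x $ j = \<beta>\<close> with \<open>\<beta> > 0\<close>, take \<open>\<beta>\<close> largest in modulus among
  the hyperplanes parallel to it, and \<open>c = v $ i = v $ j\<close>. Then only the coordinates \<open>i\<close> and \<open>j\<close> matter. Given
  \<open>X $ i + X $ j\<close>, their joint contribution is a nondecreasing function of the modulus of the
  difference of the projected coordinates. Exchanging the noise in coordinates \<open>i\<close> and \<open>j\<close> shows
  that the outer element makes this modulus larger, so a mean just inside prefers the outer element.
\<close>

section \<open>Projections onto cells far out along a hyperplane\<close>

text \<open>Only the component along \<open>a\<close> has to move, so the problem reduces to
  projecting \<open>a \<bullet> y\<close> onto \<open>I\<close>. Minimality is Cauchy-Schwarz, which
  is an equality for displacements along \<open>a\<close>.\<close>

lemma closest_point_inner_preimage: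
  fixes a y :: "'a::euclidean_space"
  assumes "a \<noteq> 0" "closed I" "convex I" "I \<noteq> {}"
  shows "closest_point {x. a \<bullet> x \<in> I} y =
    y + ((closest_point I (a \<bullet> y) - a \<bullet> y) / (a \<bullet> a)) *\<^sub>R a" (is "_ = ?q")
proof -
  let ?c = "closest_point I (a \<bullet> y)"
  have aq: "a \<bullet> ?q = ?c"
    using assms(1) by (simp add: inner_add_right)
  have cI: "?c \<in> I"
    using assms by (simp add: closest_point_in_set)
  have "?q = closest_point {x. a \<bullet> x \<in> I} y"
  proof (rule closest_point_unique)
    have "{x. a \<bullet> x \<in> I} = (\<lambda>x. a \<bullet> x) -` I"
      by auto
    moreover have "convex ((\<lambda>x. a \<bullet> x) -` I)"
      using assms(3) by (intro convex_linear_vimage) (simp_all add: bounded_linear.linear bounded_linear_inner_right)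
    moreover have "closed ((\<lambda>x. a \<bullet> x) -` I)"
      using assms(2) by (intro continuous_closed_vimage) auto
    ultimately show "convex {x. a \<bullet> x \<in> I}" "closed {x. a \<bullet> x \<in> I}"
      by simp_all
    show "?q \<in> {x. a \<bullet> x \<in> I}"
      using aq cI by simp
    show "\<forall>z\<in>{x. a \<bullet> x \<in> I}. dist y ?q \<le> dist y z"
    proof safe
      fix z assume z: "a \<bullet> z \<in> I"
      have "norm a * dist y ?q = dist (a \<bullet> y) ?c"
      proof -
        have "dist y ?q = \<bar>?c - a \<bullet> y\<bar> / (norm a * norm a) * norm a"
          by (simp add: dist_norm dot_square_norm power2_eq_square abs_mult)
        also have "\<dots> = \<bar>?c - a \<bullet> y\<bar> / norm a"
          by simp
        finally show ?thesis
          using assms(1) by (simp add: dist_real_def abs_minus_commute)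
      qed
      also have "\<dots> \<le> dist (a \<bullet> y) (a \<bullet> z)"
        using assms(2) z by (rule closest_point_le)
      also have "\<dots> = \<bar>a \<bullet> (y - z)\<bar>"
        by (simp add: dist_real_def inner_diff_right)
      also have "\<dots> \<le> norm a * dist y z"
        unfolding dist_norm by (rule Cauchy_Schwarz_ineq2)
      finally show "dist y ?q \<le> dist y z"
        using assms(1) by simp
    qed
  qed
  then show ?thesis
    by simp
qed

text \<open>If the projection overshot \<open>t\<close>, then \<open>t\<close> would lie between two
  points of \<open>I\<close>, hence in \<open>I\<close>, and would be its own projection.\<close>

lemma closest_point_real_between:
  fixes I :: "real set"
  assumes I: "closed I" "convex I" and c: "c \<in> I" "c \<le> t"
  shows "c \<le> closest_point I t" "closest_point I t \<le> t"
proof -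
  let ?p = "closest_point I t"
  have p: "?p \<in> I" "\<bar>t - ?p\<bar> \<le> \<bar>t - c\<bar>"
    using closest_point_in_set[of I t] closest_point_le[of I c t] assms by (auto simp: dist_real_def)
  show "?p \<le> t"
  proof (rule ccontr)
    assume "\<not> ?p \<le> t"
    then have "t \<in> I"
      using mem_is_interval_1_I[of I c ?p t] I(2) c p(1) by (simp add: is_interval_convex_1)
    then show False
      using closest_point_self[of t I] \<open>\<not> ?p \<le> t\<close> by simp
  qed
  then show "c \<le> ?p"
    using p(2) c(2) by linarith
qed

lemma closest_point_real_between':
  fixes I :: "real set"
  assumes I: "closed I" "convex I" and c: "c \<in> I" "t \<le> c"
  shows "closest_point I t \<le> c" "t \<le> closest_point I t"
proof -
  let ?p = "closest_point I t"
  have p: "?p \<in> I" "\<bar>t - ?p\<bar> \<le> \<bar>t - c\<bar>"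
    using closest_point_in_set[of I t] closest_point_le[of I c t] assms by (auto simp: dist_real_def)
  show "t \<le> ?p"
  proof (rule ccontr)
    assume "\<not> t \<le> ?p"
    then have "t \<in> I"
      using mem_is_interval_1_I[of I ?p c t] I(2) c p(1) by (simp add: is_interval_convex_1)
    then show False
      using closest_point_self[of t I] \<open>\<not> t \<le> ?p\<close> by simp
  qed
  then show "?p \<le> c"
    using p(2) c(2) by linarith
qed

lemma mult_self_pos: "x \<noteq> 0 \<Longrightarrow> 0 < x * x" for x :: real
  by (metis not_real_square_gt_zero)

text \<open>Projecting each \<open>w\<close> orthogonally to \<open>u\<close> leaves a nonzero
  vector, and finitely many hyperplanes do not cover the space. The projection \<open>pr\<close> is
  self-adjoint, so the condition on \<open>pr w\<close> can be moved to \<open>pr x\<close>, which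
  is orthogonal to \<open>u\<close>.\<close>

lemma exists_orthogonal_generic:
  fixes u :: "'a::euclidean_space"
  assumes "finite A" and A: "\<And>w. w \<in> A \<Longrightarrow> \<nexists>r. w = r *\<^sub>R u"
  obtains v where "u \<bullet> v = 0" "\<And>w. w \<in> A \<Longrightarrow> w \<bullet> v \<noteq> 0"
proof -
  define pr where "pr w = w - ((w \<bullet> u) / (u \<bullet> u)) *\<^sub>R u" for w
  have "negligible (\<Union>w\<in>A. {x. pr w \<bullet> x = 0})"
  proof (rule negligible_Union)
    show "finite ((\<lambda>w. {x. pr w \<bullet> x = 0}) ` A)"
      using assms(1) by simp
    fix s assume "s \<in> (\<lambda>w. {x. pr w \<bullet> x = 0}) ` A"
    then obtain w where w: "w \<in> A" "s = {x. pr w \<bullet> x = 0}"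
      by auto
    have "pr w \<noteq> 0"
      using A[OF w(1)] by (auto simp: pr_def)
    then show "negligible s"
      unfolding w(2) by (intro negligible_hyperplane) auto
  qed
  then have "(\<Union>w\<in>A. {x. pr w \<bullet> x = 0}) \<noteq> UNIV"
    using non_negligible_UNIV by metis
  then obtain x where x: "\<And>w. w \<in> A \<Longrightarrow> pr w \<bullet> x \<noteq> 0"
    by blast
  have "pr w \<bullet> x = w \<bullet> pr x" for w
    by (simp add: pr_def inner_diff_left inner_diff_right inner_commute)
  moreover have "u \<bullet> pr x = 0"
    by (cases "u = 0") (simp_all add: pr_def inner_diff_right inner_commute)
  ultimately show thesis
    using x that[of "pr x"] by metis
qed

section \<open>Cells of a finite hyperplane arrangement\<close>

locale arrangement =
  fixes J :: "'k set" and a :: "'k \<Rightarrow> 'a::euclidean_space" and b :: "'k \<Rightarrow> real"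
  assumes finite_J: "finite J"
begin

definition complement :: "'a set" where
  "complement = UNIV - (\<Union>k\<in>J. {x. a k \<bullet> x = b k})"

text \<open>A nonnegative product expresses that \<open>y\<close> is weakly on the same side as
  \<open>x\<close>. For \<open>x\<close> in \<open>complement\<close> this is the closed polyhedral
  cell around \<open>x\<close>.\<close>

definition closed_cell :: "'a \<Rightarrow> 'a set" where
  "closed_cell x = {y. \<forall>k\<in>J. 0 \<le> (a k \<bullet> y - b k) * (a k \<bullet> x - b k)}"

lemma closed_closed_cell: "closed (closed_cell x)"
proof -
  have "closed_cell x = (\<Inter>k\<in>J. {y. 0 \<le> (a k \<bullet> y - b k) * (a k \<bullet> x - b k)})"
    by (auto simp: closed_cell_def)
  moreover have "closed {y. 0 \<le> (a k \<bullet> y - b k) * (a k \<bullet> x - b k)}" for k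
    by (intro closed_Collect_le continuous_intros)
  ultimately show ?thesis
    by auto
qed

lemma convex_closed_cell: "convex (closed_cell x)"
proof (rule convexI)
  fix y z and s t :: real
  assume h: "y \<in> closed_cell x" "z \<in> closed_cell x" "0 \<le> s" "0 \<le> t" "s + t = 1"
  show "s *\<^sub>R y + t *\<^sub>R z \<in> closed_cell x"
    unfolding closed_cell_def
  proof safe
    fix k assume k: "k \<in> J"
    have "a k \<bullet> (s *\<^sub>R y + t *\<^sub>R z) - b k = s * (a k \<bullet> y - b k) + t * (a k \<bullet> z - b k)"
    proof -
      have "b k = (s + t) * b k" using h(5) by simp
      then show ?thesis by (simp add: inner_add_right algebra_simps)
    qed
    then have "(a k \<bullet> (s *\<^sub>R y + t *\<^sub>R z) - b k) * (a k \<bullet> x - b k) =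
      s * ((a k \<bullet> y - b k) * (a k \<bullet> x - b k)) + t * ((a k \<bullet> z - b k) * (a k \<bullet> x - b k))"
      by (simp only: distrib_right mult.assoc)
    then show "0 \<le> (a k \<bullet> (s *\<^sub>R y + t *\<^sub>R z) - b k) * (a k \<bullet> x - b k)"
      using h k by (auto simp: closed_cell_def intro!: add_nonneg_nonneg mult_nonneg_nonneg[of s] mult_nonneg_nonneg[of t])
  qed
qed

text \<open>A connected set off the hyperplanes cannot change sides, by the intermediate value
  theorem. Conversely, the segment from \<open>y\<close> in the closed cell to \<open>x\<close>,
  without its endpoint \<open>y\<close>, avoids all hyperplanes, so \<open>y\<close> is a limit of
  points of the component.\<close>

lemma closure_component:
  assumes x: "x \<in> complement"
  shows "closure (connected_component_set complement x) = closed_cell x" (is "closure ?C = _")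
proof
  have off: "a k \<bullet> y \<noteq> b k" if "y \<in> complement" "k \<in> J" for y k
    using that by (auto simp: complement_def)
  have "?C \<subseteq> closed_cell x"
  proof
    fix y assume y: "y \<in> ?C"
    show "y \<in> closed_cell x"
      unfolding closed_cell_def
    proof safe
      fix k assume k: "k \<in> J"
      show "0 \<le> (a k \<bullet> y - b k) * (a k \<bullet> x - b k)"
      proof (rule ccontr)
        assume "\<not> ?thesis"
        then have "(a k \<bullet> y \<le> b k \<and> b k \<le> a k \<bullet> x) \<or> (a k \<bullet> x \<le> b k \<and> b k \<le> a k \<bullet> y)"
          by (smt (verit) mult_nonneg_nonneg mult_nonpos_nonpos)
        moreover have "x \<in> ?C"
          using x by simp
        ultimately have "\<exists>z\<in>?C. a k \<bullet> z = b k"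
          using connected_ivt_hyperplane[of ?C] y connected_connected_component by metis
        then show False
          using off[OF _ k] connected_component_subset[of complement x] by blast
      qed
    qed
  qed
  then show "closure ?C \<subseteq> closed_cell x"
    by (rule closure_minimal) (rule closed_closed_cell)
  show "closed_cell x \<subseteq> closure ?C"
  proof
    fix y assume y: "y \<in> closed_cell x"
    have C: "y + t *\<^sub>R (x - y) \<in> ?C" if t: "0 < t" "t \<le> 1" for t
    proof -
      have "closed_segment (y + t *\<^sub>R (x - y)) x \<subseteq> complement"
      proof
        fix z assume "z \<in> closed_segment (y + t *\<^sub>R (x - y)) x"
        then obtain s where s: "0 \<le> s" "s \<le> 1" "z = (1 - s) *\<^sub>R (y + t *\<^sub>R (x - y)) + s *\<^sub>R x"
          by (auto simp: in_segment)
        define r where "r = (1 - s) * (1 - t)"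
        have r: "0 \<le> r" "r < 1" "z = r *\<^sub>R y + (1 - r) *\<^sub>R x"
        proof -
          show "0 \<le> r" using s t by (simp add: r_def)
          have "r \<le> 1 * (1 - t)"
            unfolding r_def using s t by (intro mult_right_mono) auto
          then show "r < 1" using t by simp
          show "z = r *\<^sub>R y + (1 - r) *\<^sub>R x"
            by (simp add: s(3) r_def algebra_simps)
        qed
        \<comment> \<open>Multiplied by the signed value at \<open>x\<close>, the signed value at
          \<open>z\<close> is a nonnegative term plus a strictly positive one, since
          \<open>x\<close> keeps the positive weight \<open>1 - r\<close>.\<close>
        have "a k \<bullet> z \<noteq> b k" if k: "k \<in> J" for k
        proof -
          have "0 \<le> r * ((a k \<bullet> y - b k) * (a k \<bullet> x - b k))"
            using y k r by (auto simp: closed_cell_def)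
          moreover have "0 < (1 - r) * ((a k \<bullet> x - b k) * (a k \<bullet> x - b k))"
            using r(2) off[OF x k] by (intro mult_pos_pos[OF _ mult_self_pos]) auto
          moreover have "(a k \<bullet> z - b k) * (a k \<bullet> x - b k) =
            r * ((a k \<bullet> y - b k) * (a k \<bullet> x - b k)) + (1 - r) * ((a k \<bullet> x - b k) * (a k \<bullet> x - b k))"
            by (simp add: r(3) inner_add_right algebra_simps)
          ultimately show ?thesis
            by auto
        qed
        then show "z \<in> complement"
          by (auto simp: complement_def)
      qed
      then have "closed_segment (y + t *\<^sub>R (x - y)) x \<subseteq> ?C"
        by (intro connected_component_maximal) auto
      then show ?thesis
        by auto
    qed
    have "(\<lambda>n. y + (1 / real (Suc n)) *\<^sub>R (x - y)) \<longlonglongrightarrow> y + 0 *\<^sub>R (x - y)"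
      by (intro tendsto_intros LIMSEQ_Suc[OF lim_1_over_n])
    moreover have "y + (1 / real (Suc n)) *\<^sub>R (x - y) \<in> ?C" for n
      by (rule C) auto
    ultimately show "y \<in> closure ?C"
      unfolding closure_sequential scaleR_zero_left add_0_right
      by (intro exI[of _ "\<lambda>n. y + (1 / real (Suc n)) *\<^sub>R (x - y)"]) simp
  qed
qed

end

section \<open>The limit of the cells on either side of a hyperplane\<close>

text \<open>
  In the direction \<open>v\<close> along the hyperplane \<open>k\<^sub>0\<close>, every hyperplane not parallel to \<open>k\<^sub>0\<close> recedes to
  infinity.
\<close>

locale far_facet = arrangement +
  fixes k\<^sub>0 :: 'a and v :: 'b
  assumes k0_mem: "k\<^sub>0 \<in> J" and normal_nz: "a k\<^sub>0 \<noteq> 0" and orth: "a k\<^sub>0 \<bullet> v = 0"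
    and generic: "\<And>k. k \<in> J \<Longrightarrow> a k \<bullet> v = 0 \<Longrightarrow> \<exists>r. a k = r *\<^sub>R a k\<^sub>0"
begin

abbreviation "\<nu> \<equiv> a k\<^sub>0"
abbreviation "\<beta> \<equiv> b k\<^sub>0"

text \<open>The foot of the perpendicular from the origin to the hyperplane
  \<open>k\<^sub>0\<close>.\<close>

definition base :: 'b where
  "base = (\<beta> / (\<nu> \<bullet> \<nu>)) *\<^sub>R \<nu>"

text \<open>The moving mean: far out along \<open>v\<close>, on the side of hyperplane
  \<open>k\<^sub>0\<close> given by the sign of \<eta>, at a distance that tends to zero. The
  successor in the denominator avoids a division by zero at \<open>n = 0\<close>.\<close>

definition probe :: "real \<Rightarrow> nat \<Rightarrow> 'b" where
  "probe \<eta> n = real n *\<^sub>R v + (base + (\<eta> / real (Suc n)) *\<^sub>R \<nu>)"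

text \<open>The values of \<open>\<nu> \<bullet> y\<close> allowed in the limit cell. The second
  condition keeps the side of \<beta> with respect to each parallel hyperplane, but is void for one
  through \<beta> itself; the first condition therefore chooses the side of
  \<open>k\<^sub>0\<close>.\<close>

definition slab :: "real \<Rightarrow> real set" where
  "slab \<eta> = {t. 0 \<le> \<eta> * (t - \<beta>) \<and>
     (\<forall>k\<in>J. \<forall>r. a k = r *\<^sub>R \<nu> \<longrightarrow> 0 \<le> (r * t - b k) * (r * \<beta> - b k))}"

text \<open>The projection onto the limit cell in closed form; \<open>slab_point_eq\<close>
  identifies it.\<close>

definition slab_point :: "real \<Rightarrow> 'b \<Rightarrow> 'b" where
  "slab_point \<eta> y = y + ((closest_point (slab \<eta>) (\<nu> \<bullet> y) - \<nu> \<bullet> y) / (\<nu> \<bullet> \<nu>)) *\<^sub>R \<nu>"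

lemma inner_base: "\<nu> \<bullet> base = \<beta>"
  using normal_nz by (simp add: base_def)

lemma parallel_inner_base:
  assumes "k \<in> J" "a k \<bullet> v = 0"
  obtains r where "a k = r *\<^sub>R \<nu>" "a k \<bullet> base = r * \<beta>"
  using generic[OF assms] inner_base by auto

lemma beta_in_slab: "\<beta> \<in> slab \<eta>"
  by (simp add: slab_def)

lemma slab_side: "t \<in> slab \<eta> \<Longrightarrow> 0 \<le> \<eta> * (t - \<beta>)"
  by (simp add: slab_def)

lemma closed_slab: "closed (slab \<eta>)"
proof -
  have "slab \<eta> = {t. 0 \<le> \<eta> * (t - \<beta>)} \<inter>
    (\<Inter>k\<in>J. \<Inter>r\<in>{r. a k = r *\<^sub>R \<nu>}. {t. 0 \<le> (r * t - b k) * (r * \<beta> - b k)})"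
    by (auto simp: slab_def)
  moreover have "closed {t. 0 \<le> (r * t - b k) * (r * \<beta> - b k)}" for r k
    by (intro closed_Collect_le continuous_intros)
  moreover have "closed {t. 0 \<le> \<eta> * (t - \<beta>)}"
    by (intro closed_Collect_le continuous_intros)
  ultimately show ?thesis
    by (auto intro!: closed_Int closed_INT)
qed

lemma convex_slab: "convex (slab \<eta>)"
proof (rule convexI)
  fix x y s t :: real
  assume h: "x \<in> slab \<eta>" "y \<in> slab \<eta>" "0 \<le> s" "0 \<le> t" "s + t = 1"
  have s: "s = 1 - t" using h(5) by simp
  have *: "0 \<le> (c * (s * x + t * y) - d) * e"
    if "0 \<le> (c * x - d) * e" "0 \<le> (c * y - d) * e" for c d e
  proof -
    have "(c * (s * x + t * y) - d) * e = s * ((c * x - d) * e) + t * ((c * y - d) * e)"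
      unfolding s by (simp add: algebra_simps)
    then show ?thesis
      using that h by simp
  qed
  show "s *\<^sub>R x + t *\<^sub>R y \<in> slab \<eta>"
    using h(1,2) *[of 1 \<beta> \<eta>] * by (auto simp: slab_def mult.commute)
qed

text \<open>The finitely many parallel hyperplanes that do not pass through \<beta> stay at positive
  distance from it, so the slab beyond \<beta> does not degenerate to a point.\<close>

lemma slab_contains_near:
  obtains e where "0 < e" "\<And>s. 0 \<le> s \<Longrightarrow> s \<le> e \<Longrightarrow> \<beta> + s \<in> slab 1"
proof -
  have "\<forall>\<^sub>F s in at_right 0. \<forall>k\<in>J. \<forall>r. a k = r *\<^sub>R \<nu> \<longrightarrow> 0 \<le> (r * (\<beta> + s) - b k) * (r * \<beta> - b k)"
  proof (subst eventually_ball_finite_distrib[OF finite_J], safe)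
    fix k assume "k \<in> J"
    show "\<forall>\<^sub>F s in at_right 0. \<forall>r. a k = r *\<^sub>R \<nu> \<longrightarrow> 0 \<le> (r * (\<beta> + s) - b k) * (r * \<beta> - b k)"
    proof (cases "\<exists>r. a k = r *\<^sub>R \<nu>")
      case True
      then obtain r where r: "a k = r *\<^sub>R \<nu>"
        by auto
      have uniq: "r' = r" if "a k = r' *\<^sub>R \<nu>" for r'
        using that r normal_nz by simp
      have "\<forall>\<^sub>F s in at_right 0. 0 \<le> (r * (\<beta> + s) - b k) * (r * \<beta> - b k)"
      proof (cases "r * \<beta> = b k")
        case False
        have "((\<lambda>s. (r * (\<beta> + s) - b k) * (r * \<beta> - b k)) \<longlongrightarrow> (r * (\<beta> + 0) - b k) * (r * \<beta> - b k)) (at_right 0)"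
          by (intro tendsto_intros)
        moreover have "0 < (r * (\<beta> + 0) - b k) * (r * \<beta> - b k)"
          using False mult_self_pos[of "r * \<beta> - b k"] by simp
        ultimately have "\<forall>\<^sub>F s in at_right 0. 0 < (r * (\<beta> + s) - b k) * (r * \<beta> - b k)"
          by (rule order_tendstoD)
        then show ?thesis
          by eventually_elim simp
      qed simp
      then show ?thesis
        by eventually_elim (use uniq in blast)
    qed simp
  qed
  then obtain d where d: "0 < d" and
    *: "\<And>s. 0 < s \<Longrightarrow> s < d \<Longrightarrow> \<forall>k\<in>J. \<forall>r. a k = r *\<^sub>R \<nu> \<longrightarrow> 0 \<le> (r * (\<beta> + s) - b k) * (r * \<beta> - b k)"
    by (auto simp: eventually_at_right_field)
  show thesis
  proof (rule that[of "d / 2"])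
    show "0 < d / 2" using d by simp
    fix s assume "0 \<le> s" "s \<le> d / 2"
    then show "\<beta> + s \<in> slab 1"
      using *[of s] d by (cases "s = 0") (auto simp: slab_def)
  qed
qed

lemma slab_projections_ordered: "closest_point (slab (- 1)) t \<le> closest_point (slab 1) t"
  using slab_side[OF closest_point_in_set[OF closed_slab, of 1 t]]
    slab_side[OF closest_point_in_set[OF closed_slab, of "-1" t]] beta_in_slab
  by fastforce

text \<open>The slab on the upper side contains a point strictly between \<beta> and
  \<open>t\<close>, or \<open>t\<close> itself, and the projection does not fall below it. The slab
  on the lower side ends at \<beta>.\<close>

lemma slab_projections_less:
  assumes "\<beta> < t"
  shows "closest_point (slab (- 1)) t < closest_point (slab 1) t"
proof -
  obtain e where e: "0 < e" "\<And>s. 0 \<le> s \<Longrightarrow> s \<le> e \<Longrightarrow> \<beta> + s \<in> slab 1"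
    using slab_contains_near by blast
  define s where "s = min e (t - \<beta>)"
  have "\<beta> + s \<in> slab 1" "0 < s" "\<beta> + s \<le> t"
    using e assms by (auto simp: s_def)
  then have "\<beta> < closest_point (slab 1) t"
    using closest_point_real_between(1)[OF closed_slab convex_slab, of "\<beta> + s" 1 t] by simp
  moreover have "closest_point (slab (- 1)) t \<le> \<beta>"
    using slab_side[OF closest_point_in_set[OF closed_slab, of "-1" t]] beta_in_slab by fastforce
  ultimately show ?thesis
    by simp
qed

lemma inner_slab_point: "\<nu> \<bullet> slab_point \<eta> y = closest_point (slab \<eta>) (\<nu> \<bullet> y)"
  using normal_nz by (simp add: slab_point_def inner_add_right)

lemma slab_point_eq: "slab_point \<eta> y = closest_point {x. \<nu> \<bullet> x \<in> slab \<eta>} y"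
  unfolding slab_point_def
  using closest_point_inner_preimage[OF normal_nz closed_slab convex_slab, of \<eta> y] beta_in_slab[of \<eta>]
  by force

lemma slab_point_le:
  assumes "\<nu> \<bullet> z \<in> slab \<eta>"
  shows "dist y (slab_point \<eta> y) \<le> dist y z"
proof -
  have "closed ((\<lambda>x. \<nu> \<bullet> x) -` slab \<eta>)"
    using closed_slab by (intro continuous_closed_vimage) auto
  moreover have "(\<lambda>x. \<nu> \<bullet> x) -` slab \<eta> = {x. \<nu> \<bullet> x \<in> slab \<eta>}"
    by auto
  ultimately show ?thesis
    unfolding slab_point_eq using assms by (intro closest_point_le) auto
qed

lemma continuous_slab_point: "continuous_on A (slab_point \<eta>)"
proof -
  have "continuous_on UNIV (closest_point (slab \<eta>))"
    using beta_in_slab by (intro continuous_on_closest_point convex_slab closed_slab) auto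
  then have "continuous_on A (\<lambda>y. closest_point (slab \<eta>) (\<nu> \<bullet> y))"
    by (rule continuous_on_compose2) (auto intro!: continuous_intros)
  then show ?thesis
    unfolding slab_point_def using normal_nz by (intro continuous_intros) auto
qed

text \<open>Divided by \<open>n\<close>, both factors tend to the nonzero number
  \<open>a k \<bullet> v\<close>: bounded displacements do not affect the side of a receding
  hyperplane.\<close>

lemma eventually_side:
  fixes q x :: "nat \<Rightarrow> 'b"
  assumes "q \<longlonglongrightarrow> q'" "x \<longlonglongrightarrow> x'" "a k \<bullet> v \<noteq> 0"
  shows "\<forall>\<^sub>F n in sequentially. 0 <
    (a k \<bullet> (real n *\<^sub>R v + q n) - b k) * (a k \<bullet> (real n *\<^sub>R v + x n) - b k)"
proof -
  have lim: "((\<lambda>n. (a k \<bullet> (real n *\<^sub>R v + w n) - b k) / real n) \<longlonglongrightarrow> a k \<bullet> v)"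
    if "w \<longlonglongrightarrow> w'" for w w'
  proof -
    have "(\<lambda>n. a k \<bullet> v + (a k \<bullet> w n - b k) * (1 / real n)) \<longlonglongrightarrow> a k \<bullet> v + (a k \<bullet> w' - b k) * 0"
      using that by (intro tendsto_intros lim_1_over_n)
    moreover have "\<forall>\<^sub>F n in sequentially.
        a k \<bullet> v + (a k \<bullet> w n - b k) * (1 / real n) = (a k \<bullet> (real n *\<^sub>R v + w n) - b k) / real n"
      by (rule eventually_sequentiallyI[of 1]) (simp add: inner_add_right field_simps)
    ultimately show ?thesis
      by (simp add: Lim_transform_eventually)
  qed
  have "0 < (a k \<bullet> v) * (a k \<bullet> v)"
    using assms(3) by (rule mult_self_pos)
  with tendsto_mult[OF lim[OF assms(1)] lim[OF assms(2)]]
  have "\<forall>\<^sub>F n in sequentially. 0 < ((a k \<bullet> (real n *\<^sub>R v + q n) - b k) / real n) *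
    ((a k \<bullet> (real n *\<^sub>R v + x n) - b k) / real n)"
    by (rule order_tendstoD)
  then show ?thesis
    using eventually_ge_at_top[of 1]
    by eventually_elim (auto simp: zero_less_mult_iff zero_less_divide_iff divide_less_0_iff)
qed

lemma probe_offset_tendsto: "(\<lambda>n. base + (\<eta> / real (Suc n)) *\<^sub>R \<nu>) \<longlonglongrightarrow> base"
proof -
  have "(\<lambda>n. base + (\<eta> * (1 / real (Suc n))) *\<^sub>R \<nu>) \<longlonglongrightarrow> base + (\<eta> * 0) *\<^sub>R \<nu>"
    by (intro tendsto_intros LIMSEQ_Suc[OF lim_1_over_n])
  then show ?thesis
    by simp
qed

lemma eventually_probe_parallel:
  assumes "k \<in> J" "a k = r *\<^sub>R \<nu>" "r * \<beta> \<noteq> b k"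
  shows "\<forall>\<^sub>F n in sequentially. 0 < (a k \<bullet> probe \<eta> n - b k) * (r * \<beta> - b k)"
proof -
  have "(\<lambda>n. (a k \<bullet> (base + (\<eta> / real (Suc n)) *\<^sub>R \<nu>) - b k) * (r * \<beta> - b k))
      \<longlonglongrightarrow> (a k \<bullet> base - b k) * (r * \<beta> - b k)"
    by (intro tendsto_intros probe_offset_tendsto)
  moreover have "0 < (a k \<bullet> base - b k) * (r * \<beta> - b k)"
    using assms inner_base mult_self_pos[of "r * \<beta> - b k"] by simp
  ultimately have "\<forall>\<^sub>F n in sequentially.
      0 < (a k \<bullet> (base + (\<eta> / real (Suc n)) *\<^sub>R \<nu>) - b k) * (r * \<beta> - b k)"
    by (rule order_tendstoD)
  then show ?thesis
    using assms(2) orth by (simp add: probe_def inner_add_right)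
qed

lemma inner_probe: "\<nu> \<bullet> probe \<eta> n - \<beta> = \<eta> / real (Suc n) * (\<nu> \<bullet> \<nu>)"
  using inner_base orth by (simp add: probe_def inner_add_right)

text \<open>Three kinds of hyperplanes occur. Receding ones are handled by
  \<open>eventually_side\<close>, those coinciding with \<open>k\<^sub>0\<close> by the sign of
  \<eta>, and the other parallel ones by the second condition in \<open>slab\<close>.\<close>

lemma eventually_in_closed_cell:
  assumes q: "q \<longlonglongrightarrow> q'" and slab: "\<And>n. \<nu> \<bullet> q n \<in> slab \<eta>"
  shows "\<forall>\<^sub>F n in sequentially. real n *\<^sub>R v + q n \<in> closed_cell (probe \<eta> n)"
  unfolding closed_cell_def mem_Collect_eq
proof (subst eventually_ball_finite_distrib[OF finite_J], safe)
  fix k assume k: "k \<in> J"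
  show "\<forall>\<^sub>F n in sequentially. 0 \<le> (a k \<bullet> (real n *\<^sub>R v + q n) - b k) * (a k \<bullet> probe \<eta> n - b k)"
  proof (cases "a k \<bullet> v = 0")
    case False
    show ?thesis
      unfolding probe_def
      using eventually_side[OF q probe_offset_tendsto[of \<eta>] False]
      by (rule eventually_mono) (rule less_imp_le)
  next
    case True
    then obtain r where r: "a k = r *\<^sub>R \<nu>" "a k \<bullet> base = r * \<beta>"
      using parallel_inner_base k by blast
    have qv: "a k \<bullet> (real n *\<^sub>R v + q n) - b k = r * (\<nu> \<bullet> q n) - b k" for n
      using r orth by (simp add: inner_add_right)
    show ?thesis
    proof (cases "r * \<beta> = b k")
      case eq: True
      have "(a k \<bullet> (real n *\<^sub>R v + q n) - b k) * (a k \<bullet> probe \<eta> n - b k) =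
        (r * r * (\<nu> \<bullet> \<nu>) / real (Suc n)) * (\<eta> * (\<nu> \<bullet> q n - \<beta>))" for n
      proof -
        have "a k \<bullet> probe \<eta> n - b k = r * (\<nu> \<bullet> probe \<eta> n - \<beta>)"
          using r eq by (simp add: algebra_simps)
        moreover have "r * (\<nu> \<bullet> q n) - b k = r * (\<nu> \<bullet> q n - \<beta>)"
          using eq by (simp add: algebra_simps)
        ultimately show ?thesis
          unfolding qv inner_probe by simp
      qed
      then show ?thesis
        using slab_side[OF slab] by (auto intro!: always_eventually mult_nonneg_nonneg divide_nonneg_nonneg)
    next
      case neq: False
      have "0 \<le> (r * (\<nu> \<bullet> q n) - b k) * (r * \<beta> - b k)" for n
        using slab[of n] k r(1) by (auto simp: slab_def)
      with eventually_probe_parallel[OF k r(1) neq, of \<eta>] show ?thesis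
        unfolding qv
        by (auto elim!: eventually_mono simp: zero_le_mult_iff zero_less_mult_iff)
    qed
  qed
qed

text \<open>Only the hyperplanes parallel to \<open>k\<^sub>0\<close> are used, and for these the
  side of the probe is eventually that of \<beta>. The threshold for \<open>n\<close> is uniform in
  \<open>z\<close>, so that minimality can be tested against the whole cell at once.\<close>

lemma eventually_closed_cell_slab:
  assumes "\<eta> \<noteq> 0"
  shows "\<forall>\<^sub>F n in sequentially. \<forall>z\<in>closed_cell (probe \<eta> n). \<nu> \<bullet> (z - real n *\<^sub>R v) \<in> slab \<eta>"
proof -
  have "\<forall>\<^sub>F n in sequentially. \<forall>k\<in>J. \<forall>r. a k = r *\<^sub>R \<nu> \<longrightarrow> r * \<beta> \<noteq> b k \<longrightarrow>
      0 < (a k \<bullet> probe \<eta> n - b k) * (r * \<beta> - b k)"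
  proof (subst eventually_ball_finite_distrib[OF finite_J], safe)
    fix k assume k: "k \<in> J"
    show "\<forall>\<^sub>F n in sequentially. \<forall>r. a k = r *\<^sub>R \<nu> \<longrightarrow> r * \<beta> \<noteq> b k \<longrightarrow>
      0 < (a k \<bullet> probe \<eta> n - b k) * (r * \<beta> - b k)"
    proof (cases "\<exists>r. a k = r *\<^sub>R \<nu> \<and> r * \<beta> \<noteq> b k")
      case True
      then obtain r where r: "a k = r *\<^sub>R \<nu>" "r * \<beta> \<noteq> b k"
        by auto
      have uniq: "r' = r" if "a k = r' *\<^sub>R \<nu>" for r'
        using that r normal_nz by simp
      show ?thesis
        using eventually_probe_parallel[OF k r, of \<eta>] by (rule eventually_mono) (use uniq in blast)
    qed auto
  qed
  then show ?thesis
  proof eventually_elim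
    case (elim n)
    show ?case
    proof
      fix z assume z: "z \<in> closed_cell (probe \<eta> n)"
      have zn: "\<nu> \<bullet> (z - real n *\<^sub>R v) = \<nu> \<bullet> z"
        using orth by (simp add: inner_diff_right)
      have "0 \<le> (\<nu> \<bullet> z - \<beta>) * (\<nu> \<bullet> probe \<eta> n - \<beta>)"
        using z k0_mem by (auto simp: closed_cell_def)
      then have "0 \<le> ((\<nu> \<bullet> \<nu>) / real (Suc n)) * (\<eta> * (\<nu> \<bullet> z - \<beta>))"
        unfolding inner_probe by (simp add: mult_ac)
      moreover have "0 < (\<nu> \<bullet> \<nu>) / real (Suc n)"
        using normal_nz by simp
      ultimately have "0 \<le> \<eta> * (\<nu> \<bullet> z - \<beta>)"
        by (simp only: zero_le_mult_iff) auto
      moreover have "0 \<le> (r * (\<nu> \<bullet> z) - b k) * (r * \<beta> - b k)" if k: "k \<in> J" and r: "a k = r *\<^sub>R \<nu>" for k r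
      proof (cases "r * \<beta> = b k")
        case False
        then have "0 < (a k \<bullet> probe \<eta> n - b k) * (r * \<beta> - b k)"
          using elim k r by blast
        moreover have "0 \<le> (r * (\<nu> \<bullet> z) - b k) * (a k \<bullet> probe \<eta> n - b k)"
          using z k r by (auto simp: closed_cell_def)
        ultimately show ?thesis
          by (smt (verit) zero_le_mult_iff zero_less_mult_iff)
      qed simp
      ultimately show "\<nu> \<bullet> (z - real n *\<^sub>R v) \<in> slab \<eta>"
        unfolding zn by (auto simp: slab_def)
    qed
  qed
qed

text \<open>The cell is eventually contained in the translated slab, while the projection onto that
  slab eventually lies in the cell. A minimizer over the larger set that belongs to the smaller set
  is also the minimizer there.\<close>

lemma eventually_closest_point_closed_cell:
  assumes "\<eta> \<noteq> 0" "y \<longlonglongrightarrow> y'"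
  shows "\<forall>\<^sub>F n in sequentially.
    closest_point (closed_cell (probe \<eta> n)) (real n *\<^sub>R v + y n) = real n *\<^sub>R v + slab_point \<eta> (y n)"
proof -
  have "(\<lambda>n. slab_point \<eta> (y n)) \<longlonglongrightarrow> slab_point \<eta> y'"
    using continuous_slab_point[of UNIV \<eta>] assms(2)
    by (auto simp: continuous_on_eq_continuous_at intro: isCont_tendsto_compose)
  moreover have "\<nu> \<bullet> slab_point \<eta> (y n) \<in> slab \<eta>" for n
    unfolding inner_slab_point using beta_in_slab closed_slab by (auto intro!: closest_point_in_set)
  ultimately have "\<forall>\<^sub>F n in sequentially. real n *\<^sub>R v + slab_point \<eta> (y n) \<in> closed_cell (probe \<eta> n)"
    by (rule eventually_in_closed_cell)
  with eventually_closed_cell_slab[OF assms(1)] show ?thesis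
  proof eventually_elim
    case (elim n)
    show ?case
    proof (rule sym, rule closest_point_unique[OF convex_closed_cell closed_closed_cell elim(2)], safe)
      fix z assume "z \<in> closed_cell (probe \<eta> n)"
      then have "dist (y n) (slab_point \<eta> (y n)) \<le> dist (y n) (z - real n *\<^sub>R v)"
        using elim(1) by (intro slab_point_le) auto
      also have "\<dots> = dist (real n *\<^sub>R v + y n) z"
        by (simp add: dist_norm algebra_simps)
      finally show "dist (real n *\<^sub>R v + y n) (real n *\<^sub>R v + slab_point \<eta> (y n)) \<le>
          dist (real n *\<^sub>R v + y n) z"
        by simp
    qed
  qed
qed

lemma eventually_probe_in_complement:
  assumes "\<eta> \<noteq> 0" and nz_all: "\<And>k. k \<in> J \<Longrightarrow> a k \<noteq> 0"
  shows "\<forall>\<^sub>F n in sequentially. probe \<eta> n \<in> complement"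
proof -
  have "\<forall>\<^sub>F n in sequentially. \<forall>k\<in>J. a k \<bullet> probe \<eta> n \<noteq> b k"
  proof (subst eventually_ball_finite_distrib[OF finite_J], safe)
    fix k assume k: "k \<in> J"
    show "\<forall>\<^sub>F n in sequentially. a k \<bullet> probe \<eta> n \<noteq> b k"
    proof (cases "a k \<bullet> v = 0")
      case False
      show ?thesis
        using eventually_side[OF probe_offset_tendsto probe_offset_tendsto False, of \<eta> \<eta>]
        unfolding probe_def by eventually_elim auto
    next
      case True
      then obtain r where r: "a k = r *\<^sub>R \<nu>"
        using generic k by blast
      show ?thesis
      proof (cases "r * \<beta> = b k")
        case eq: True
        have "a k \<bullet> probe \<eta> n - b k = r * (\<nu> \<bullet> probe \<eta> n - \<beta>)" for n
          using r eq by (simp add: algebra_simps)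
        then have "a k \<bullet> probe \<eta> n - b k \<noteq> 0" for n
          unfolding inner_probe using assms(1) normal_nz nz_all[OF k] r by auto
        then show ?thesis
          by simp
      next
        case False
        show ?thesis
          using eventually_probe_parallel[OF k r False, of \<eta>] by eventually_elim auto
      qed
    qed
  qed
  then show ?thesis
    by eventually_elim (auto simp: complement_def)
qed

end

section \<open>Gaussian vectors\<close>

lemma borel_measurable_vec_lambda:
  "(\<lambda>f. \<chi> i. f i) \<in> borel_measurable (\<Pi>\<^sub>M i\<in>(UNIV :: 'n::finite set). (borel :: real measure))"
  by (rule borel_measurable_euclidean_space[THEN iffD2])
    (auto simp: Basis_vec_def inner_axis intro!: measurable_component_singleton)

lemma normal_model_measurable:
  assumes "normal_model \<sigma> \<mu> M X"
  shows "X \<in> borel_measurable M"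
proof -
  have "(\<lambda>\<omega>. X \<omega> $ i) \<in> borel_measurable M" for i
    using assms measurable_lborel1 unfolding normal_model_def by (auto dest!: spec[of _ i] distributed_measurable)
  then show ?thesis
    by (intro borel_measurable_euclidean_space[THEN iffD2]) (auto simp: Basis_vec_def inner_axis)
qed

text \<open>By independence the joint law is the product of the prescribed marginals. Hence only
  \<sigma> and \<mu> matter, and not the probability space that a model chooses for each
  mean.\<close>

lemma normal_model_distr_unique:
  assumes "normal_model \<sigma> \<mu> M X" "normal_model \<sigma> \<mu> N Y"
  shows "distr M borel X = distr N borel Y"
proof -
  have *: "distr M borel X =
      distr (\<Pi>\<^sub>M i\<in>UNIV. density lborel (\<lambda>x. ennreal (normal_density (\<mu> $ i) \<sigma> x))) borel (\<lambda>f. \<chi> i. f i)"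
    if nm: "normal_model \<sigma> \<mu> M X" for M :: "'m measure" and X
  proof -
    interpret prob_space M
      using nm by (simp add: normal_model_def)
    have [measurable]: "(\<lambda>\<omega>. X \<omega> $ i) \<in> borel_measurable M" for i
      using measurable_compose[OF normal_model_measurable[OF nm] borel_measurable_nth] by simp
    have [measurable]: "(\<lambda>\<omega>. \<lambda>i\<in>UNIV. X \<omega> $ i) \<in> M \<rightarrow>\<^sub>M (\<Pi>\<^sub>M i\<in>UNIV. borel)"
      by (intro measurable_restrict) measurable
    have D: "distr M borel (\<lambda>\<omega>. X \<omega> $ i) = density lborel (\<lambda>x. ennreal (normal_density (\<mu> $ i) \<sigma> x))" for i
    proof -
      have "distr M borel (\<lambda>\<omega>. X \<omega> $ i) = distr M lborel (\<lambda>\<omega>. X \<omega> $ i)"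
        by (rule distr_cong) auto
      then show ?thesis
        using nm by (simp add: normal_model_def distributed_distr_eq_density)
    qed
    have "distr M borel X = distr (distr M (\<Pi>\<^sub>M i\<in>UNIV. borel) (\<lambda>\<omega>. \<lambda>i\<in>UNIV. X \<omega> $ i)) borel (\<lambda>f. \<chi> i. f i)"
      by (subst distr_distr[OF borel_measurable_vec_lambda]) (auto simp: comp_def vec_eq_iff intro!: distr_cong)
    moreover have "distr M (\<Pi>\<^sub>M i\<in>UNIV. borel) (\<lambda>\<omega>. \<lambda>i\<in>UNIV. X \<omega> $ i) = (\<Pi>\<^sub>M i\<in>UNIV. distr M borel (\<lambda>\<omega>. X \<omega> $ i))"
      using nm by (subst indep_vars_iff_distr_eq_PiM[symmetric]) (auto simp: normal_model_def)
    ultimately show ?thesis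
      by (simp only: D)
  qed
  show ?thesis
    using *[OF assms(1)] *[OF assms(2)] by simp
qed

text \<open>Refers all means to one fixed noise law, so that limits along moving means become limits
  of integrands.\<close>

lemma normal_model_translate:
  assumes "0 < \<sigma>" "normal_model \<sigma> 0 M X"
  shows "normal_model \<sigma> \<mu> M (\<lambda>\<omega>. \<mu> + X \<omega>)"
proof -
  interpret prob_space M
    using assms by (simp add: normal_model_def)
  have "distributed M lborel (\<lambda>\<omega>. \<mu> $ i + 1 * X \<omega> $ i) (normal_density (\<mu> $ i + 1 * 0) (\<bar>1\<bar> * \<sigma>))" for i
    using assms by (intro normal_density_affine) (auto simp: normal_model_def)
  moreover have "indep_vars (\<lambda>_. borel) (\<lambda>i \<omega>. \<mu> $ i + X \<omega> $ i) UNIV"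
    using indep_vars_compose2[where X = "\<lambda>i \<omega>. X \<omega> $ i" and Y = "\<lambda>i x. \<mu> $ i + x" and M' = "\<lambda>_. borel"
      and N = "\<lambda>_. borel" and I = UNIV] assms(2)
    by (simp add: normal_model_def)
  ultimately show ?thesis
    using prob_space_axioms by (simp add: normal_model_def)
qed

text \<open>The centred coordinates are independent and identically distributed, hence exchangeable:
  reindexing a product of equal factors preserves it.\<close>

lemma normal_model_permute:
  fixes X :: "'w \<Rightarrow> real ^ 'n"
  assumes "bij p" "normal_model \<sigma> 0 M X"
  shows "normal_model \<sigma> 0 M (\<lambda>\<omega>. \<chi> i. X \<omega> $ p i)"
proof -
  interpret prob_space M
    using assms by (simp add: normal_model_def)
  have [measurable]: "(\<lambda>\<omega>. X \<omega> $ i) \<in> borel_measurable M" for i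
    using measurable_compose[OF normal_model_measurable[OF assms(2)] borel_measurable_nth] by simp
  have D: "distributed M lborel (\<lambda>\<omega>. X \<omega> $ i) (normal_density 0 \<sigma>)" for i
    using assms by (simp add: normal_model_def)
  have ind: "indep_vars (\<lambda>_. borel) (\<lambda>i \<omega>. X \<omega> $ i) UNIV"
    using assms by (simp add: normal_model_def)
  let ?D = "\<lambda>i. distr M borel (\<lambda>\<omega>. X \<omega> $ i)"
  have R: "(\<lambda>\<omega>. \<lambda>i\<in>UNIV. \<omega> (p i)) \<in> (\<Pi>\<^sub>M i\<in>UNIV. borel) \<rightarrow>\<^sub>M (\<Pi>\<^sub>M i\<in>UNIV. (borel :: real measure))"
    by (intro measurable_restrict measurable_component_singleton) auto
  let ?P = "\<Pi>\<^sub>M i\<in>UNIV. (borel :: real measure)" and ?r = "\<lambda>\<omega>. \<lambda>i\<in>UNIV. \<omega> (p i)"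
  have joint: "distr M ?P (\<lambda>\<omega>. \<lambda>i\<in>UNIV. X \<omega> $ i) = (\<Pi>\<^sub>M i\<in>UNIV. ?D i)"
    using ind by (subst indep_vars_iff_distr_eq_PiM[symmetric]) auto
  have "distr M ?P (\<lambda>\<omega>. \<lambda>i\<in>UNIV. X \<omega> $ p i) = distr (distr M ?P (\<lambda>\<omega>. \<lambda>i\<in>UNIV. X \<omega> $ i)) ?P ?r"
    by (subst distr_distr[OF R]) (auto simp: comp_def intro!: measurable_restrict)
  also have "\<dots> = distr (\<Pi>\<^sub>M i\<in>UNIV. ?D i) (\<Pi>\<^sub>M i\<in>UNIV. ?D (p i)) ?r"
    unfolding joint by (rule distr_cong) (auto intro!: sets_PiM_cong)
  also have "\<dots> = (\<Pi>\<^sub>M i\<in>UNIV. ?D (p i))"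
    using assms(1) by (intro distr_PiM_reindex prob_space_distr) (auto simp: bij_def)
  finally have "indep_vars (\<lambda>_. borel) (\<lambda>i \<omega>. X \<omega> $ p i) UNIV"
    by (subst indep_vars_iff_distr_eq_PiM) auto
  then show ?thesis
    using D prob_space_axioms by (simp add: normal_model_def)
qed

lemma normal_model_integrable_norm:
  assumes "0 < \<sigma>" "normal_model \<sigma> 0 M X"
  shows "integrable M (\<lambda>\<omega>. norm (X \<omega>))"
proof (rule Bochner_Integration.integrable_bound)
  have [measurable]: "X \<in> borel_measurable M"
    using normal_model_measurable[OF assms(2)] .
  show "(\<lambda>\<omega>. norm (X \<omega>)) \<in> borel_measurable M"
    by measurable
  have "integrable M (\<lambda>\<omega>. X \<omega> $ i)" for i
  proof (rule distributed_integrable_var)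
    show "distributed M lborel (\<lambda>\<omega>. X \<omega> $ i) (\<lambda>x. ennreal (normal_density 0 \<sigma> x))"
      using assms by (simp add: normal_model_def)
    show "integrable lborel (\<lambda>x. normal_density 0 \<sigma> x * x)"
      using assms(1) by (rule integrable_normal_moment_nz_1)
  qed simp
  then show "integrable M (\<lambda>\<omega>. \<Sum>i\<in>UNIV. \<bar>X \<omega> $ i\<bar>)"
    by (intro Bochner_Integration.integrable_sum integrable_abs)
  show "AE \<omega> in M. norm (norm (X \<omega>)) \<le> norm (\<Sum>i\<in>UNIV. \<bar>X \<omega> $ i\<bar>)"
  proof (rule AE_I2)
    fix \<omega>
    show "norm (norm (X \<omega>)) \<le> norm (\<Sum>i\<in>UNIV. \<bar>X \<omega> $ i\<bar>)"
      using norm_le_l1_cart[of "X \<omega>"] by simp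
  qed
qed

text \<open>The Gaussian law has full support: \<open>G\<close> contains a box around
  \<open>x\<close>, whose probability is a product of positive interval probabilities.\<close>

lemma normal_model_prob_open_pos:
  fixes X :: "'w \<Rightarrow> real ^ 'n"
  assumes "0 < \<sigma>" "normal_model \<sigma> \<mu> M X" "open G" "x \<in> G"
  shows "0 < measure M (X -` G \<inter> space M)"
proof -
  interpret prob_space M
    using assms by (simp add: normal_model_def)
  have X[measurable]: "X \<in> borel_measurable M"
    using normal_model_measurable[OF assms(2)] .
  obtain c d where cd: "x \<in> box c d" "box c d \<subseteq> G"
    by (rule open_contains_box[OF assms(3,4)]) (rule that)
  have pos: "0 < prob ((\<lambda>\<omega>. X \<omega> $ i) -` {c $ i <..< d $ i} \<inter> space M)" for i
  proof -
    have lt: "c $ i < d $ i"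
      using cd(1) unfolding mem_box_cart by (metis less_trans)
    have D: "distributed M lborel (\<lambda>\<omega>. X \<omega> $ i) (\<lambda>x. ennreal (normal_density (\<mu> $ i) \<sigma> x))"
      using assms by (simp add: normal_model_def)
    have "emeasure M ((\<lambda>\<omega>. X \<omega> $ i) -` {c $ i <..< d $ i} \<inter> space M) =
      (\<integral>\<^sup>+ y. ennreal (normal_density (\<mu> $ i) \<sigma> y) * indicator {c $ i <..< d $ i} y \<partial>lborel)"
      using D by (rule distributed_emeasure) auto
    moreover have "\<dots> \<noteq> 0"
    proof
      assume "(\<integral>\<^sup>+ y. ennreal (normal_density (\<mu> $ i) \<sigma> y) * indicator {c $ i <..< d $ i} y \<partial>lborel) = 0"
      then have "AE y in lborel. ennreal (normal_density (\<mu> $ i) \<sigma> y) * indicator {c $ i <..< d $ i} y = 0"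
        by (subst (asm) nn_integral_0_iff_AE) auto
      then have "AE y in lborel. y \<notin> {c $ i <..< d $ i}"
      proof eventually_elim
        case (elim y)
        then show ?case
          using normal_density_pos[OF assms(1), of "\<mu> $ i" y] by (simp add: indicator_def split: if_splits)
      qed
      then have "emeasure lborel {c $ i <..< d $ i} = 0"
        by (subst (asm) AE_iff_measurable[of "{c $ i <..< d $ i}"]) auto
      then show False
        using lt by simp
    qed
    ultimately have "prob ((\<lambda>\<omega>. X \<omega> $ i) -` {c $ i <..<d $ i} \<inter> space M) \<noteq> 0"
      unfolding measure_def by (metis emeasure_eq_measure ennreal_0 measure_def)
    then show ?thesis
      unfolding zero_less_measure_iff .
  qed
  have "0 < (\<Prod>i\<in>UNIV. prob ((\<lambda>\<omega>. X \<omega> $ i) -` {c $ i <..< d $ i} \<inter> space M))"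
    using pos by (intro prod_pos) auto
  also have "\<dots> = prob (\<Inter>i\<in>UNIV. (\<lambda>\<omega>. X \<omega> $ i) -` {c $ i <..< d $ i} \<inter> space M)"
    using assms(2) by (intro indep_varsD[symmetric, where I = UNIV]) (auto simp: normal_model_def)
  also have "\<dots> \<le> prob (X -` G \<inter> space M)"
  proof (rule finite_measure_mono)
    show "X -` G \<inter> space M \<in> events"
      using \<open>open G\<close> by (intro measurable_sets[OF X]) auto
    show "(\<Inter>i\<in>UNIV. (\<lambda>\<omega>. X \<omega> $ i) -` {c $ i <..< d $ i} \<inter> space M) \<subseteq> X -` G \<inter> space M"
      using cd(2) by (auto simp: mem_box_cart subset_iff)
  qed
  finally show ?thesis .
qed

lemma integral_pos_of_open:
  fixes X :: "'w \<Rightarrow> real ^ 'n" and f :: "real ^ 'n \<Rightarrow> real"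
  assumes "0 < \<sigma>" "normal_model \<sigma> \<mu> M X" and int: "integrable (distr M borel X) f"
    and nonneg: "\<And>z. 0 \<le> f z" and G: "open G" "x \<in> G" "\<And>z. z \<in> G \<Longrightarrow> 0 < f z"
  shows "0 < integral\<^sup>L (distr M borel X) f"
proof (rule ccontr)
  assume neg: "\<not> ?thesis"
  have "0 \<le> integral\<^sup>L (distr M borel X) f"
    by (rule integral_nonneg_AE) (simp add: nonneg)
  with neg have "integral\<^sup>L (distr M borel X) f = 0"
    by simp
  then have "AE z in distr M borel X. f z = 0"
    using integral_nonneg_eq_0_iff_AE[OF int] nonneg by auto
  then have "AE z in distr M borel X. z \<notin> G"
  proof eventually_elim
    case (elim z)
    then show ?case
      using G(3)[of z] by auto
  qed
  then have "emeasure (distr M borel X) G = 0"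
    using G(1) by (subst (asm) AE_iff_measurable[of G]) auto
  then show False
    using normal_model_prob_open_pos[OF assms(1,2) G(1,2)] normal_model_measurable[OF assms(2)] G(1)
    by (simp add: emeasure_distr measure_def)
qed

section \<open>Limits of the utility comparison\<close>

text \<open>The total utility at observation \<open>y\<close> for the hinge function with kink
  \<open>c\<close>, when the reported element has closure \<open>Q\<close>.\<close>

definition payoff :: "real \<Rightarrow> (real ^ 'n) set \<Rightarrow> real ^ 'n \<Rightarrow> real" where
  "payoff c Q y = (\<Sum>i\<in>UNIV. max 0 (closest_point Q y $ i - c))"

lemma payoff_nonneg: "0 \<le> payoff c Q y"
  unfolding payoff_def by (intro sum_nonneg) simp

lemma borel_measurable_payoff:
  fixes Q :: "(real ^ 'n) set"
  assumes "convex Q" "closed Q" "Q \<noteq> {}"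
  shows "(\<lambda>z. payoff c Q (\<mu> + z)) \<in> borel_measurable borel"
proof -
  have "continuous_on UNIV (closest_point Q)"
    using assms by (rule continuous_on_closest_point)
  then have "continuous_on UNIV (\<lambda>z. closest_point Q (\<mu> + z))"
    by (rule continuous_on_compose2) (auto intro!: continuous_intros)
  then show ?thesis
    unfolding payoff_def by (intro borel_measurable_continuous_onI continuous_intros)
qed

text \<open>Projection onto a closed convex set is nonexpansive, so the payoff grows at most
  linearly in the noise.\<close>

lemma payoff_le:
  fixes Q :: "(real ^ 'n) set"
  assumes "convex Q" "closed Q" "Q \<noteq> {}"
  shows "payoff c Q (\<mu> + z) \<le> real CARD('n) * (norm (closest_point Q \<mu>) + norm z + \<bar>c\<bar>)"
proof -
  have "max 0 (closest_point Q (\<mu> + z) $ i - c) \<le> norm (closest_point Q \<mu>) + norm z + \<bar>c\<bar>" for i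
  proof -
    have "dist (closest_point Q (\<mu> + z)) (closest_point Q \<mu>) \<le> dist (\<mu> + z) \<mu>"
      using assms by (rule closest_point_lipschitz)
    then have "norm (closest_point Q (\<mu> + z)) \<le> norm (closest_point Q \<mu>) + norm z"
      using norm_triangle_sub[of "closest_point Q (\<mu> + z)" "closest_point Q \<mu>"] by (simp add: dist_norm)
    then show ?thesis
      using component_le_norm_cart[of "closest_point Q (\<mu> + z)" i] by auto
  qed
  then have "payoff c Q (\<mu> + z) \<le> (\<Sum>i\<in>(UNIV :: 'n set). norm (closest_point Q \<mu>) + norm z + \<bar>c\<bar>)"
    unfolding payoff_def by (intro sum_mono)
  then show ?thesis
    by simp
qed

lemma integrable_affine_norm:
  fixes \<gamma> :: "(real ^ 'n) measure"
  assumes "prob_space \<gamma>" "integrable \<gamma> norm"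
  shows "integrable \<gamma> (\<lambda>z. A * (B + norm z + C))"
proof -
  interpret prob_space \<gamma> by fact
  show ?thesis
    using assms(2) by (intro integrable_mult_right Bochner_Integration.integrable_add) auto
qed

lemma integrable_payoff:
  fixes \<gamma> :: "(real ^ 'n) measure"
  assumes "prob_space \<gamma>" "sets \<gamma> = sets borel" "integrable \<gamma> norm"
    and Q: "convex Q" "closed Q" "Q \<noteq> {}"
  shows "integrable \<gamma> (\<lambda>z. payoff c Q (\<mu> + z))"
proof (rule Bochner_Integration.integrable_bound)
  show "integrable \<gamma> (\<lambda>z. real CARD('n) * (norm (closest_point Q \<mu>) + norm z + \<bar>c\<bar>))"
    using assms by (intro integrable_affine_norm)
  show "(\<lambda>z. payoff c Q (\<mu> + z)) \<in> borel_measurable \<gamma>"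
    using borel_measurable_payoff[OF Q] assms(2) by (simp cong: measurable_cong_sets)
  show "AE z in \<gamma>. norm (payoff c Q (\<mu> + z)) \<le> norm (real CARD('n) * (norm (closest_point Q \<mu>) + norm z + \<bar>c\<bar>))"
    using payoff_le[OF Q] by (intro AE_I2) (simp add: abs_mult abs_of_nonneg payoff_nonneg)
qed

lemma noise_law:
  assumes "0 < \<sigma>" "normal_model \<sigma> 0 M X"
  shows "prob_space (distr M borel X)" "sets (distr M borel X) = sets borel" "integrable (distr M borel X) norm"
proof -
  note X = normal_model_measurable[OF assms(2)]
  show "prob_space (distr M borel X)"
    using assms(2) X by (intro prob_space.prob_space_distr) (auto simp: normal_model_def)
  show "integrable (distr M borel X) norm"
    using normal_model_integrable_norm[OF assms] X by (subst integrable_distr_eq) auto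
qed simp

text \<open>The hinge is nonnegative, so the negative part of the extended expectation vanishes, and
  linear growth makes the positive part finite. Only the law of the observation enters, and this is
  the translated noise law.\<close>

lemma Util_hinge:
  fixes X :: "'w \<Rightarrow> real ^ 'n"
  assumes \<sigma>: "0 < \<sigma>" and nm: "normal_model \<sigma> \<mu> M X" and nm0: "normal_model \<sigma> 0 M\<^sub>0 X\<^sub>0"
    and S: "convex (closure S)" "S \<noteq> {}"
  shows "Util M X (\<lambda>x. max 0 (x - c)) S = ereal (integral\<^sup>L (distr M\<^sub>0 borel X\<^sub>0) (\<lambda>z. payoff c (closure S) (\<mu> + z)))"
proof -
  have Q: "convex (closure S)" "closed (closure S)" "closure S \<noteq> {}"
    using S by auto
  have p[measurable]: "payoff c (closure S) \<in> borel_measurable borel"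
    using borel_measurable_payoff[OF Q, of c 0] by simp
  have pm[measurable]: "(\<lambda>z. payoff c (closure S) (\<mu> + z)) \<in> borel_measurable borel"
    by (rule borel_measurable_payoff[OF Q])
  note [measurable] = normal_model_measurable[OF nm] normal_model_measurable[OF nm0]
  have "(\<integral>\<^sup>+ \<omega>. ennreal (payoff c (closure S) (X \<omega>)) \<partial>M) =
      (\<integral>\<^sup>+ y. ennreal (payoff c (closure S) y) \<partial>distr M borel X)"
    by (subst nn_integral_distr) auto
  also have "distr M borel X = distr M\<^sub>0 borel (\<lambda>\<omega>. \<mu> + X\<^sub>0 \<omega>)"
    using nm normal_model_translate[OF \<sigma> nm0] by (rule normal_model_distr_unique)
  also have "(\<integral>\<^sup>+ y. ennreal (payoff c (closure S) y) \<partial>distr M\<^sub>0 borel (\<lambda>\<omega>. \<mu> + X\<^sub>0 \<omega>)) =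
      (\<integral>\<^sup>+ \<omega>. ennreal (payoff c (closure S) (\<mu> + X\<^sub>0 \<omega>)) \<partial>M\<^sub>0)"
    by (subst nn_integral_distr) auto
  also have "\<dots> = (\<integral>\<^sup>+ z. ennreal (payoff c (closure S) (\<mu> + z)) \<partial>distr M\<^sub>0 borel X\<^sub>0)"
    by (subst nn_integral_distr) auto
  also have "\<dots> = ennreal (integral\<^sup>L (distr M\<^sub>0 borel X\<^sub>0) (\<lambda>z. payoff c (closure S) (\<mu> + z)))"
    using integrable_payoff[OF noise_law[OF \<sigma> nm0] Q] by (intro nn_integral_eq_integral AE_I2 payoff_nonneg)
  finally have pos: "(\<integral>\<^sup>+ \<omega>. ennreal (payoff c (closure S) (X \<omega>)) \<partial>M) = \<dots>" .
  have neg: "(\<integral>\<^sup>+ \<omega>. ennreal (- payoff c (closure S) (X \<omega>)) \<partial>M) = 0"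
    by (simp add: ennreal_neg payoff_nonneg)
  have "Util M X (\<lambda>x. max 0 (x - c)) S = ext_expectation M (\<lambda>\<omega>. payoff c (closure S) (X \<omega>))"
    by (simp add: Util_def payoff_def mechanism_def)
  then show ?thesis
    unfolding ext_expectation_def pos neg
    by (simp add: enn2ereal_ennreal zero_ennreal.rep_eq integral_nonneg_AE payoff_nonneg)
qed

text \<open>An element squeezed between a component and its closure has the same closure as the
  component. The allocation of boundary points is therefore invisible to the mechanism.\<close>

lemma partition_element:
  assumes lkp: "linear_knowledge_partition \<S> K H"
    and H: "\<And>k. k \<in> {1..K} \<Longrightarrow> H k = {x. a k \<bullet> x = b k}"
    and x: "x \<in> arrangement.complement {1..K} a b"
  obtains S where "S \<in> \<S>" "x \<in> S" "closure S = arrangement.closed_cell {1..K} a b x"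
proof -
  interpret arrangement "{1..K}" a b
    by standard simp
  have U: "UNIV - (\<Union>k\<in>{1..K}. H k) = complement"
    using H unfolding complement_def by simp
  have "connected_component_set complement x \<in> components (UNIV - (\<Union>k\<in>{1..K}. H k))"
    unfolding U using x by (rule componentsI)
  then obtain S where S: "S \<in> \<S>" "connected_component_set complement x \<subseteq> S"
      "S \<subseteq> closure (connected_component_set complement x)"
    using lkp unfolding linear_knowledge_partition_def by meson
  show thesis
  proof
    show "S \<in> \<S>" by fact
    show "x \<in> S"
      using S(2) x connected_component_refl[of x complement] by auto
    have "closure S = closure (connected_component_set complement x)"
      using S(2,3) by (metis closure_mono closure_closure subset_antisym)
    then show "closure S = closed_cell x"
      using closure_component[OF x] by simp
  qed
qed

lemma hinge_mono_convex: "mono (\<lambda>x. max 0 (x - c))" "convex_on UNIV (\<lambda>x. max 0 (x - c))" for c :: real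
proof -
  show "mono (\<lambda>x. max 0 (x - c))"
    by (auto simp: mono_def)
  show "convex_on UNIV (\<lambda>x. max 0 (x - c))"
  proof (intro convex_onI convex_UNIV)
    fix t x y :: real
    assume t: "0 < t" "t < 1"
    have "(1 - t) *\<^sub>R x + t *\<^sub>R y - c = (1 - t) * (x - c) + t * (y - c)"
      by (simp add: algebra_simps)
    moreover have "(1 - t) * (x - c) \<le> (1 - t) * max 0 (x - c)" "t * (y - c) \<le> t * max 0 (y - c)"
      using t by (auto intro!: mult_left_mono)
    moreover have "0 \<le> (1 - t) * max 0 (x - c)" "0 \<le> t * max 0 (y - c)"
      using t by auto
    ultimately show "max 0 ((1 - t) *\<^sub>R x + t *\<^sub>R y - c) \<le> (1 - t) * max 0 (x - c) + t * max 0 (y - c)"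
      by auto
  qed
qed

lemma truthful_payoff_le:
  fixes M :: "real ^ 'n \<Rightarrow> 'w measure"
  assumes \<sigma>: "0 < \<sigma>" and nm: "\<And>\<mu>. normal_model \<sigma> \<mu> (M \<mu>) (X \<mu>)"
    and lkp: "linear_knowledge_partition \<S> K H" and tr: "truthful M X \<S>"
    and H: "\<And>k. k \<in> {1..K} \<Longrightarrow> H k = {x. a k \<bullet> x = b k}"
    and x: "x \<in> arrangement.complement {1..K} a b" and y: "y \<in> arrangement.complement {1..K} a b"
  shows "integral\<^sup>L (distr (M 0) borel (X 0)) (\<lambda>z. payoff c (arrangement.closed_cell {1..K} a b y) (x + z))
    \<le> integral\<^sup>L (distr (M 0) borel (X 0)) (\<lambda>z. payoff c (arrangement.closed_cell {1..K} a b x) (x + z))"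
proof -
  interpret arrangement "{1..K}" a b
    by standard simp
  obtain S where S: "S \<in> \<S>" "x \<in> S" "closure S = closed_cell x"
    using partition_element[OF lkp H x] by blast
  obtain T where T: "T \<in> \<S>" "y \<in> T" "closure T = closed_cell y"
    using partition_element[OF lkp H y] by blast
  have "Util (M x) (X x) (\<lambda>x. max 0 (x - c)) T \<le> Util (M x) (X x) (\<lambda>x. max 0 (x - c)) S"
    using tr hinge_mono_convex[of c] S T unfolding truthful_def by blast
  moreover have "convex (closure S)" "convex (closure T)" "S \<noteq> {}" "T \<noteq> {}"
    using S T convex_closed_cell by auto
  ultimately show ?thesis
    using Util_hinge[OF \<sigma> nm nm] S(3) T(3) by simp
qed

section \<open>Dominated convergence along the moving means\<close>

lemma eventually_affine_pos:
  fixes x :: "nat \<Rightarrow> real"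
  assumes "x \<longlonglongrightarrow> l" "0 < d"
  shows "\<forall>\<^sub>F n in sequentially. 0 < real n * d + x n"
proof -
  have "filterlim (\<lambda>n. d * real n) at_top sequentially"
    by (rule filterlim_tendsto_pos_mult_at_top[OF tendsto_const assms(2) filterlim_real_sequentially])
  then have "filterlim (\<lambda>n. real n * d) at_top sequentially"
    by (simp only: mult.commute)
  then have "filterlim (\<lambda>n. x n + real n * d) at_top sequentially"
    by (rule filterlim_tendsto_add_at_top[OF assms(1)])
  then show ?thesis
    by (simp add: filterlim_at_top_dense add.commute)
qed

text \<open>What remains of \<open>max 0 (real n * d + x)\<close> for large \<open>n\<close>, up to
  the divergent term \<open>real n * d\<close> when \<open>d\<close> is positive.\<close>

definition hinge_limit :: "real \<Rightarrow> real \<Rightarrow> real" where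
  "hinge_limit d x = (if 0 < d then x else if d < 0 then 0 else max 0 x)"

lemma hinge_diff_tendsto:
  fixes x y :: "nat \<Rightarrow> real"
  assumes x: "x \<longlonglongrightarrow> l" and y: "y \<longlonglongrightarrow> m"
  shows "(\<lambda>n. max 0 (real n * d + x n) - max 0 (real n * d + y n)) \<longlonglongrightarrow> hinge_limit d l - hinge_limit d m"
proof -
  consider "0 < d" | "d < 0" | "d = 0" by linarith
  then show ?thesis
  proof cases
    case 1
    have "\<forall>\<^sub>F n in sequentially. x n - y n = max 0 (real n * d + x n) - max 0 (real n * d + y n)"
      using eventually_affine_pos[OF x 1] eventually_affine_pos[OF y 1] by eventually_elim simp
    with tendsto_diff[OF x y] show ?thesis
      using 1 by (simp add: hinge_limit_def Lim_transform_eventually)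
  next
    case 2
    have "\<forall>\<^sub>F n in sequentially. 0 = max 0 (real n * d + x n) - max 0 (real n * d + y n)"
      using eventually_affine_pos[OF tendsto_minus[OF x], of "- d", simplified, OF 2]
        eventually_affine_pos[OF tendsto_minus[OF y], of "- d", simplified, OF 2]
      by eventually_elim simp
    from Lim_transform_eventually[OF tendsto_const this] show ?thesis
      using 2 by (simp add: hinge_limit_def)
  next
    case 3
    then show ?thesis
      using x y by (auto simp: hinge_limit_def intro!: tendsto_intros)
  qed
qed

text \<open>Each payoff alone may diverge, but their difference is controlled by the distance
  between the two projections. Both cells eventually contain
  \<open>real n *\<^sub>R v + base\<close>, so neither projection is farther from the observation
  than this point, which gives a bound independent of \<open>n\<close>. The kink
  \<open>real n * c\<close> moves along with the mean.\<close>

lemma payoff_gap_limit: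
  fixes a :: "'k \<Rightarrow> real ^ 'n" and \<gamma> :: "(real ^ 'n) measure" and c :: real
  assumes ff: "far_facet J a k\<^sub>0 v"
    and \<gamma>: "prob_space \<gamma>" "sets \<gamma> = sets borel" "integrable \<gamma> norm"
    and \<eta>: "\<eta> \<noteq> 0"
    and le: "\<forall>\<^sub>F n in sequentially.
      integral\<^sup>L \<gamma> (\<lambda>z. payoff (real n * c) (arrangement.closed_cell J a b (far_facet.probe a b k\<^sub>0 v (- \<eta>) n))
        (far_facet.probe a b k\<^sub>0 v \<eta> n + z))
      \<le> integral\<^sup>L \<gamma> (\<lambda>z. payoff (real n * c) (arrangement.closed_cell J a b (far_facet.probe a b k\<^sub>0 v \<eta> n))
        (far_facet.probe a b k\<^sub>0 v \<eta> n + z))"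
  defines "G \<equiv> \<lambda>z. \<Sum>i\<in>UNIV.
      hinge_limit (v $ i - c) (far_facet.slab_point J a b k\<^sub>0 \<eta> (far_facet.base a b k\<^sub>0 + z) $ i) -
      hinge_limit (v $ i - c) (far_facet.slab_point J a b k\<^sub>0 (- \<eta>) (far_facet.base a b k\<^sub>0 + z) $ i)"
  shows "integrable \<gamma> G" "0 \<le> integral\<^sup>L \<gamma> G"
proof -
  interpret far_facet J a b k\<^sub>0 v by fact
  interpret \<gamma>: prob_space \<gamma> by fact
  define Q where "Q s n = closed_cell (probe (s * \<eta>) n)" for s n
  define f where "f n z = payoff (real n * c) (Q 1 n) (probe \<eta> n + z) - payoff (real n * c) (Q (- 1) n) (probe \<eta> n + z)"
    for n z
  have Q: "convex (Q s n)" "closed (Q s n)" for s n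
    unfolding Q_def by (rule convex_closed_cell closed_closed_cell)+
  have in_Q: "\<forall>\<^sub>F n in sequentially. real n *\<^sub>R v + base \<in> Q s n" for s
    unfolding Q_def using beta_in_slab inner_base
    by (intro eventually_in_closed_cell[OF tendsto_const]) auto
  have le': "\<forall>\<^sub>F n in sequentially.
      integral\<^sup>L \<gamma> (\<lambda>z. payoff (real n * c) (Q (- 1) n) (probe \<eta> n + z)) \<le>
      integral\<^sup>L \<gamma> (\<lambda>z. payoff (real n * c) (Q 1 n) (probe \<eta> n + z))"
    using le by (simp add: Q_def)
  \<comment> \<open>Dominated convergence is applied to the sequence started at \<open>N\<close>,
    from where both cells are nonempty and the utility comparison holds.\<close>
  obtain N where N: "\<And>n s. N \<le> n \<Longrightarrow> s \<in> {1, - 1} \<Longrightarrow> real n *\<^sub>R v + base \<in> Q s n"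
      "\<And>n. N \<le> n \<Longrightarrow> integral\<^sup>L \<gamma> (\<lambda>z. payoff (real n * c) (Q (- 1) n) (probe \<eta> n + z)) \<le>
      integral\<^sup>L \<gamma> (\<lambda>z. payoff (real n * c) (Q 1 n) (probe \<eta> n + z))"
    using eventually_conj[OF eventually_conj[OF in_Q[of 1] in_Q[of "- 1"]] le']
    unfolding eventually_sequentially by auto
  have int: "integrable \<gamma> (\<lambda>z. payoff (real n * c) (Q s n) (probe \<eta> n + z))" if "N \<le> n" "s \<in> {1, - 1}" for n s
    using N(1)[OF that] by (intro integrable_payoff \<gamma> Q) auto
  have meas: "f (n + N) \<in> borel_measurable \<gamma>" for n
    unfolding f_def by (intro borel_measurable_diff borel_measurable_integrable int) auto
  have bound: "\<bar>f n z\<bar> \<le> real CARD('n) * (\<bar>\<eta>\<bar> * norm \<nu> + norm z + (\<bar>\<eta>\<bar> * norm \<nu> + norm z))" if "N \<le> n" for n z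
  proof -
    define y where "y = probe \<eta> n + z"
    have "\<bar>1 / real (Suc n)\<bar> * (\<bar>\<eta>\<bar> * norm \<nu>) \<le> 1 * (\<bar>\<eta>\<bar> * norm \<nu>)"
      by (intro mult_right_mono) auto
    then have "dist y (real n *\<^sub>R v + base) \<le> \<bar>\<eta>\<bar> * norm \<nu> + norm z"
      unfolding y_def probe_def dist_norm by (auto intro!: norm_triangle_le simp: algebra_simps)
    then have *: "dist y (closest_point (Q s n) y) \<le> \<bar>\<eta>\<bar> * norm \<nu> + norm z" if "s \<in> {1, - 1}" for s
      using closest_point_le[OF Q(2) N(1)[OF \<open>N \<le> n\<close> that], of y] by linarith
    have "dist (closest_point (Q 1 n) y) (closest_point (Q (- 1) n) y) \<le>
        \<bar>\<eta>\<bar> * norm \<nu> + norm z + (\<bar>\<eta>\<bar> * norm \<nu> + norm z)"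
      using dist_triangle3[of "closest_point (Q 1 n) y" "closest_point (Q (- 1) n) y" y] *[of 1] *[of "- 1"] by simp
    then have comp: "\<bar>closest_point (Q 1 n) y $ i - closest_point (Q (- 1) n) y $ i\<bar> \<le>
        \<bar>\<eta>\<bar> * norm \<nu> + norm z + (\<bar>\<eta>\<bar> * norm \<nu> + norm z)" for i
      using component_le_norm_cart[of "closest_point (Q 1 n) y - closest_point (Q (- 1) n) y" i]
      by (simp add: dist_norm)
    have "\<bar>f n z\<bar> \<le> (\<Sum>i\<in>(UNIV :: 'n set). \<bar>\<eta>\<bar> * norm \<nu> + norm z + (\<bar>\<eta>\<bar> * norm \<nu> + norm z))"
      unfolding f_def payoff_def sum_subtractf[symmetric] y_def[symmetric]
    proof (intro order_trans[OF sum_abs] sum_mono)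
      fix i
      show "\<bar>max 0 (closest_point (Q 1 n) y $ i - real n * c) - max 0 (closest_point (Q (- 1) n) y $ i - real n * c)\<bar>
          \<le> \<bar>\<eta>\<bar> * norm \<nu> + norm z + (\<bar>\<eta>\<bar> * norm \<nu> + norm z)"
        using comp[of i] by linarith
    qed
    then show ?thesis
      by simp
  qed
  have dom: "integrable \<gamma> (\<lambda>z. real CARD('n) * (\<bar>\<eta>\<bar> * norm \<nu> + norm z + (\<bar>\<eta>\<bar> * norm \<nu> + norm z)))"
    using \<gamma>(3) by (intro integrable_mult_right Bochner_Integration.integrable_add) auto
  have lim: "(\<lambda>n. f n z) \<longlonglongrightarrow> G z" for z
  proof -
    define y where "y n = base + (\<eta> / real (Suc n)) *\<^sub>R \<nu> + z" for n
    have y: "y \<longlonglongrightarrow> base + z"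
      unfolding y_def by (intro tendsto_intros probe_offset_tendsto)
    have sp: "(\<lambda>n. slab_point s (y n)) \<longlonglongrightarrow> slab_point s (base + z)" for s
      using continuous_slab_point[of UNIV s] y
      by (auto simp: continuous_on_eq_continuous_at intro: isCont_tendsto_compose)
    have "(\<lambda>n. \<Sum>i\<in>UNIV. max 0 (real n * (v $ i - c) + slab_point \<eta> (y n) $ i) -
        max 0 (real n * (v $ i - c) + slab_point (- \<eta>) (y n) $ i)) \<longlonglongrightarrow> G z"
      unfolding G_def by (intro tendsto_sum hinge_diff_tendsto tendsto_vec_nth sp)
    moreover have "\<forall>\<^sub>F n in sequentially. (\<Sum>i\<in>UNIV. max 0 (real n * (v $ i - c) + slab_point \<eta> (y n) $ i) -
        max 0 (real n * (v $ i - c) + slab_point (- \<eta>) (y n) $ i)) = f n z"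
    proof -
      have shift: "probe \<eta> n + z = real n *\<^sub>R v + y n" for n
        by (simp add: probe_def y_def)
      have "- \<eta> \<noteq> 0"
        using \<eta> by simp
      from eventually_closest_point_closed_cell[OF \<eta> y] eventually_closest_point_closed_cell[OF this y]
      show ?thesis
      proof eventually_elim
        case (elim n)
        then show ?case
          unfolding f_def payoff_def Q_def shift by (simp add: sum_subtractf right_diff_distrib add_diff_eq diff_add_eq)
      qed
    qed
    ultimately show ?thesis
      by (rule Lim_transform_eventually)
  qed
  have lim': "AE z in \<gamma>. (\<lambda>n. f (n + N) z) \<longlonglongrightarrow> G z"
    using lim by (intro AE_I2 LIMSEQ_ignore_initial_segment)
  have Gm: "G \<in> borel_measurable \<gamma>"
    by (rule borel_measurable_LIMSEQ_real[OF _ meas]) (rule LIMSEQ_ignore_initial_segment[OF lim])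
  have bound': "AE z in \<gamma>. norm (f (n + N) z) \<le> real CARD('n) * (\<bar>\<eta>\<bar> * norm \<nu> + norm z + (\<bar>\<eta>\<bar> * norm \<nu> + norm z))" for n
    using bound[of "n + N"] by (intro AE_I2) auto
  show "integrable \<gamma> G"
    by (rule integrable_dominated_convergence[OF Gm meas dom lim' bound'])
  have "(\<lambda>n. integral\<^sup>L \<gamma> (f (n + N))) \<longlonglongrightarrow> integral\<^sup>L \<gamma> G"
    by (rule integral_dominated_convergence[OF Gm meas dom lim' bound'])
  moreover have "0 \<le> integral\<^sup>L \<gamma> (f (n + N))" for n
    unfolding f_def using N(2)[of "n + N"] int[of "n + N" 1] int[of "n + N" "- 1"]
    by (subst Bochner_Integration.integral_diff) auto
  ultimately show "0 \<le> integral\<^sup>L \<gamma> G"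
    by (intro LIMSEQ_le_const) auto
qed

lemma (in far_facet) slab_point_component_diff:
  "slab_point \<eta> y - slab_point \<theta> y =
    ((closest_point (slab \<eta>) (\<nu> \<bullet> y) - closest_point (slab \<theta>) (\<nu> \<bullet> y)) / (\<nu> \<bullet> \<nu>)) *\<^sub>R \<nu>"
  by (simp add: slab_point_def scaleR_diff_left[symmetric] diff_divide_distrib)

text \<open>Truthfulness for a mean on the side \<eta> of hyperplane \<open>k\<^sub>0\<close>,
  compared with reporting the cell just across it. Both probes eventually avoid all hyperplanes, so
  each determines an element of the partition.\<close>

lemma truthful_limit:
  fixes M :: "real ^ 'n \<Rightarrow> 'w measure" and a :: "nat \<Rightarrow> real ^ 'n" and c :: real
  assumes \<sigma>: "0 < \<sigma>" and nm: "\<And>\<mu>. normal_model \<sigma> \<mu> (M \<mu>) (X \<mu>)"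
    and lkp: "linear_knowledge_partition \<S> K H" and tr: "truthful M X \<S>"
    and H: "\<And>k. k \<in> {1..K} \<Longrightarrow> H k = {x. a k \<bullet> x = b k}"
    and nz: "\<And>k. k \<in> {1..K} \<Longrightarrow> a k \<noteq> 0"
    and ff: "far_facet {1..K} a k\<^sub>0 v" and \<eta>: "\<eta> \<noteq> 0"
  defines "G \<equiv> \<lambda>z. \<Sum>i\<in>UNIV.
      hinge_limit (v $ i - c) (far_facet.slab_point {1..K} a b k\<^sub>0 \<eta> (far_facet.base a b k\<^sub>0 + z) $ i) -
      hinge_limit (v $ i - c) (far_facet.slab_point {1..K} a b k\<^sub>0 (- \<eta>) (far_facet.base a b k\<^sub>0 + z) $ i)"
  shows "integrable (distr (M 0) borel (X 0)) G" "0 \<le> integral\<^sup>L (distr (M 0) borel (X 0)) G"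
proof -
  interpret far_facet "{1..K}" a b k\<^sub>0 v by fact
  have "- \<eta> \<noteq> 0"
    using \<eta> by simp
  then have "\<forall>\<^sub>F n in sequentially. probe \<eta> n \<in> complement \<and> probe (- \<eta>) n \<in> complement"
    using nz \<eta> by (intro eventually_conj eventually_probe_in_complement)
  then have le: "\<forall>\<^sub>F n in sequentially.
      integral\<^sup>L (distr (M 0) borel (X 0)) (\<lambda>z. payoff (real n * c) (closed_cell (probe (- \<eta>) n)) (probe \<eta> n + z))
      \<le> integral\<^sup>L (distr (M 0) borel (X 0)) (\<lambda>z. payoff (real n * c) (closed_cell (probe \<eta> n)) (probe \<eta> n + z))"
  proof eventually_elim
    case (elim n)
    then show ?case
      using truthful_payoff_le[OF \<sigma> nm lkp tr H, where x = "probe \<eta> n" and y = "probe (- \<eta>) n"]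
      by blast
  qed
  show "integrable (distr (M 0) borel (X 0)) G" "0 \<le> integral\<^sup>L (distr (M 0) borel (X 0)) G"
    unfolding G_def using payoff_gap_limit[OF ff noise_law[OF \<sigma> nm] \<eta> le] by auto
qed

section \<open>Normals are multiples of differences of unit vectors\<close>

text \<open>One threshold suffices for a contradiction: just below the largest coordinate of
  \<open>v\<close> on the support of \<nu>. Then a single coordinate \<open>m\<close> with
  \<open>\<nu> $ m \<noteq> 0\<close> contributes, and the two signs of \<eta> give opposite strict
  demands.\<close>

lemma truthful_normal_is_difference:
  fixes M :: "real ^ 'n \<Rightarrow> 'w measure" and a :: "nat \<Rightarrow> real ^ 'n"
  assumes \<sigma>: "0 < \<sigma>" and nm: "\<And>\<mu>. normal_model \<sigma> \<mu> (M \<mu>) (X \<mu>)"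
    and lkp: "linear_knowledge_partition \<S> K H" and tr: "truthful M X \<S>"
    and H: "\<And>k. k \<in> {1..K} \<Longrightarrow> H k = {x. a k \<bullet> x = b k}"
    and nz: "\<And>k. k \<in> {1..K} \<Longrightarrow> a k \<noteq> 0" and k0: "k\<^sub>0 \<in> {1..K}"
  shows "\<exists>i j r. i \<noteq> j \<and> a k\<^sub>0 = r *\<^sub>R (axis i 1 - axis j 1)"
proof (rule ccontr)
  assume no: "\<not> ?thesis"
  \<comment> \<open>The vectors to which \<open>v\<close> must not be orthogonal: the nonparallel
    normals, so that their hyperplanes recede, and all differences of unit vectors, so that
    \<open>v\<close> has distinct coordinates.\<close>
  define A where "A = {a k | k. k \<in> {1..K} \<and> (\<nexists>r. a k = r *\<^sub>R a k\<^sub>0)} \<union>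
    (\<lambda>(i, j). axis i 1 - axis j 1) ` {(i, j). i \<noteq> j}"
  have "finite A"
    unfolding A_def by auto
  moreover have "\<nexists>r. w = r *\<^sub>R a k\<^sub>0" if w: "w \<in> A" for w
  proof
    assume "\<exists>r. w = r *\<^sub>R a k\<^sub>0"
    then obtain r where r: "w = r *\<^sub>R a k\<^sub>0"
      by blast
    with w have "w \<in> (\<lambda>(i, j). axis i 1 - axis j 1) ` {(i, j). i \<noteq> j}"
      unfolding A_def by blast
    then obtain i j where ij: "i \<noteq> j" "w = axis i 1 - axis j 1"
      by auto
    then have "w $ i = 1"
      by (simp add: axis_def)
    then have "r \<noteq> 0"
      using r by auto
    then have "a k\<^sub>0 = (1 / r) *\<^sub>R (axis i 1 - axis j 1)"
      using r ij by simp
    then show False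
      using no ij by blast
  qed
  ultimately obtain v where v: "a k\<^sub>0 \<bullet> v = 0" "\<And>w. w \<in> A \<Longrightarrow> w \<bullet> v \<noteq> 0"
    using exists_orthogonal_generic by blast
  have distinct: "v $ i \<noteq> v $ j" if "i \<noteq> j" for i j
  proof -
    have "axis i 1 - axis j 1 \<in> A"
      using that unfolding A_def by auto
    from v(2)[OF this] show ?thesis
      by (simp add: inner_diff_left inner_axis')
  qed
  have ff: "far_facet {1..K} a k\<^sub>0 v"
  proof
    show "a k\<^sub>0 \<noteq> 0" "k\<^sub>0 \<in> {1..K}"
      using nz k0 by auto
    show "\<exists>r. a k = r *\<^sub>R a k\<^sub>0" if "k \<in> {1..K}" "a k \<bullet> v = 0" for k
      using v(2)[of "a k"] that unfolding A_def by blast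
  qed (use v in auto)
  interpret far_facet "{1..K}" a b k\<^sub>0 v by fact
  let ?I = "{i. \<nu> $ i \<noteq> 0}"
  have "?I \<noteq> {}"
    using normal_nz by (auto simp: vec_eq_iff)
  then have "Max ((\<lambda>i. v $ i) ` ?I) \<in> (\<lambda>i. v $ i) ` ?I"
    by (intro Max_in) auto
  then obtain m where m: "\<nu> $ m \<noteq> 0" "v $ m = Max ((\<lambda>i. v $ i) ` ?I)"
    by auto
  have m_max: "v $ i \<le> v $ m" if "\<nu> $ i \<noteq> 0" for i
    unfolding m(2) using that by (intro Max_ge) auto
  \<comment> \<open>Half the gap \<open>d\<close> puts \<open>c\<close> above every coordinate of
    \<open>v\<close> that is smaller than \<open>v $ m\<close>. Larger coordinates lie outside the
    support of \<nu> and cancel.\<close>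
  obtain d where d: "0 < d" "\<And>i. v $ i \<noteq> v $ m \<Longrightarrow> d \<le> dist (v $ m) (v $ i)"
    using finite_set_avoid[of "range (\<lambda>i. v $ i)" "v $ m"] by auto
  define c where "c = v $ m - d / 2"
  define \<kappa> where "\<kappa> z = closest_point (slab 1) (\<nu> \<bullet> (base + z)) - closest_point (slab (- 1)) (\<nu> \<bullet> (base + z))" for z
  define \<gamma> where "\<gamma> = distr (M 0) borel (X 0)"
  have gap: "(\<Sum>i\<in>UNIV. hinge_limit (v $ i - c) (slab_point \<eta> (base + z) $ i) -
      hinge_limit (v $ i - c) (slab_point (- \<eta>) (base + z) $ i)) = \<eta> * \<kappa> z * (\<nu> $ m / (\<nu> \<bullet> \<nu>))"
    if "\<eta> = 1 \<or> \<eta> = - 1" for \<eta> z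
  proof -
    have cp: "closest_point (slab \<eta>) (\<nu> \<bullet> (base + z)) - closest_point (slab (- \<eta>)) (\<nu> \<bullet> (base + z)) = \<eta> * \<kappa> z"
      using that by (auto simp: \<kappa>_def)
    have "hinge_limit (v $ i - c) (slab_point \<eta> (base + z) $ i) -
      hinge_limit (v $ i - c) (slab_point (- \<eta>) (base + z) $ i) =
      (if i = m then \<eta> * \<kappa> z * (\<nu> $ m / (\<nu> \<bullet> \<nu>)) else 0)" for i
    proof -
      have D: "slab_point \<eta> (base + z) $ i - slab_point (- \<eta>) (base + z) $ i = \<eta> * \<kappa> z * (\<nu> $ i / (\<nu> \<bullet> \<nu>))"
        using arg_cong[OF slab_point_component_diff[of \<eta> "base + z" "- \<eta>"], of "\<lambda>w. w $ i"]
        unfolding cp by simp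
      consider "i = m" | "i \<noteq> m" "v $ i < v $ m" | "i \<noteq> m" "v $ m < v $ i"
        using distinct[of i m] by linarith
      then show ?thesis
      proof cases
        case 1
        then have "0 < v $ i - c"
          using d(1) by (simp add: c_def)
        then show ?thesis
          using D 1 by (simp add: hinge_limit_def)
      next
        case 2
        then have "v $ i - c < 0"
          using d(1) d(2)[of i] by (auto simp: c_def dist_real_def)
        then show ?thesis
          using 2 by (simp add: hinge_limit_def)
      next
        case 3
        then have "0 < v $ i - c" "\<nu> $ i = 0"
          using d(1) m_max[of i] by (auto simp: c_def)
        then show ?thesis
          using D 3 by (simp add: hinge_limit_def)
      qed
    qed
    then show ?thesis
      by simp
  qed
  have lim: "integrable \<gamma> (\<lambda>z. \<eta> * \<kappa> z * (\<nu> $ m / (\<nu> \<bullet> \<nu>)))"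
      "0 \<le> integral\<^sup>L \<gamma> (\<lambda>z. \<eta> * \<kappa> z * (\<nu> $ m / (\<nu> \<bullet> \<nu>)))" if \<eta>: "\<eta> = 1 \<or> \<eta> = - 1" for \<eta>
  proof -
    have "\<eta> \<noteq> 0"
      using \<eta> by auto
    note * = truthful_limit[OF \<sigma> nm lkp tr H nz ff this, where c = c, folded \<gamma>_def]
    show "integrable \<gamma> (\<lambda>z. \<eta> * \<kappa> z * (\<nu> $ m / (\<nu> \<bullet> \<nu>)))"
      "0 \<le> integral\<^sup>L \<gamma> (\<lambda>z. \<eta> * \<kappa> z * (\<nu> $ m / (\<nu> \<bullet> \<nu>)))"
      using * unfolding gap[OF \<eta>] by auto
  qed
  have ratio: "\<nu> $ m / (\<nu> \<bullet> \<nu>) \<noteq> 0"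
    using m(1) normal_nz by simp
  have int: "integrable \<gamma> \<kappa>"
    using lim(1)[of 1] ratio by (simp only: mult_1_left integrable_mult_left_iff integrable_mult_right_iff simp_thms)
  have "0 < integral\<^sup>L \<gamma> \<kappa>"
    unfolding \<gamma>_def
  proof (rule integral_pos_of_open[OF \<sigma> nm])
    show "integrable (distr (M 0) borel (X 0)) \<kappa>"
      using int by (simp add: \<gamma>_def)
    show "0 \<le> \<kappa> z" for z
      using slab_projections_ordered[of "\<nu> \<bullet> (base + z)"] by (simp add: \<kappa>_def)
    \<comment> \<open>On this half-space \<open>\<nu> \<bullet> (base + z)\<close> exceeds \<beta>,
      where the two projections differ strictly.\<close>
    show "open {z. 0 < \<nu> \<bullet> z}"
      by (intro open_Collect_less continuous_intros)
    show "\<nu> \<in> {z. 0 < \<nu> \<bullet> z}"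
      using normal_nz by simp
    show "0 < \<kappa> z" if "z \<in> {z. 0 < \<nu> \<bullet> z}" for z
      using slab_projections_less[of "\<nu> \<bullet> (base + z)"] that by (simp add: \<kappa>_def inner_add_right inner_base)
  qed
  moreover have "integral\<^sup>L \<gamma> \<kappa> * (\<nu> $ m / (\<nu> \<bullet> \<nu>)) = 0"
    using lim(2)[of 1] lim(2)[of "- 1"] by simp
  ultimately show False
    using ratio by simp
qed

section \<open>Offsets vanish\<close>

text \<open>As a function of \<open>x\<close> the sum is convex and even, hence nondecreasing in the
  modulus of \<open>x\<close>.\<close>

lemma hinge_pair_mono:
  fixes s x y :: real
  assumes "\<bar>x\<bar> \<le> y"
  shows "max 0 (s + x / 2) + max 0 (s - x / 2) \<le> max 0 (s + y / 2) + max 0 (s - y / 2)"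
  using assms by (auto simp: max_def abs_if split: if_splits)

text \<open>The sum is constant for modulus up to \<open>2 * \<bar>s\<bar>\<close> and strictly
  increasing in the modulus beyond that.\<close>

lemma hinge_pair_strict_mono:
  fixes s x y :: real
  assumes "\<bar>x\<bar> < y" "2 * \<bar>s\<bar> < y"
  shows "max 0 (s + x / 2) + max 0 (s - x / 2) < max 0 (s + y / 2) + max 0 (s - y / 2)"
  using assms by (auto simp: max_def abs_if split: if_splits)

lemma closest_point_atLeast: "closest_point {b..} t = max b t" for t :: real
  by (rule closest_point_unique[symmetric]) (auto simp: dist_real_def)

text \<open>The hypothesis \<open>outer\<close> bounds the normalised offsets of all parallel
  hyperplanes by \<beta>, so the limit cell beyond \<beta> is a half-space. A mean just inside then
  prefers this cell if \<beta> is positive.\<close>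

lemma truthful_no_outermost_offset:
  fixes M :: "real ^ 'n \<Rightarrow> 'w measure" and a :: "nat \<Rightarrow> real ^ 'n"
  assumes \<sigma>: "0 < \<sigma>" and nm: "\<And>\<mu>. normal_model \<sigma> \<mu> (M \<mu>) (X \<mu>)"
    and lkp: "linear_knowledge_partition \<S> K H" and tr: "truthful M X \<S>"
    and H: "\<And>k. k \<in> {1..K} \<Longrightarrow> H k = {x. a k \<bullet> x = b k}"
    and nz: "\<And>k. k \<in> {1..K} \<Longrightarrow> a k \<noteq> 0" and k0: "k\<^sub>0 \<in> {1..K}"
    and ij: "i \<noteq> j" and ak0: "a k\<^sub>0 = axis i 1 - axis j 1"
    and outer: "\<And>k r. k \<in> {1..K} \<Longrightarrow> a k = r *\<^sub>R a k\<^sub>0 \<Longrightarrow> \<bar>b k\<bar> \<le> \<bar>r\<bar> * b k\<^sub>0"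
  shows "b k\<^sub>0 \<le> 0"
proof (rule ccontr)
  assume "\<not> ?thesis"
  then have \<beta>: "0 < b k\<^sub>0"
    by simp
  \<comment> \<open>Orthogonality to the normal forces \<open>v $ i = v $ j\<close>; only the
    remaining coordinates have to differ from this common value.\<close>
  define A where "A = {a k | k. k \<in> {1..K} \<and> (\<nexists>r. a k = r *\<^sub>R a k\<^sub>0)} \<union>
    (\<lambda>l. axis i 1 - axis l 1) ` {l. l \<noteq> i \<and> l \<noteq> j}"
  have "finite A"
    unfolding A_def by auto
  moreover have "\<nexists>r. w = r *\<^sub>R a k\<^sub>0" if w: "w \<in> A" for w
  proof
    assume "\<exists>r. w = r *\<^sub>R a k\<^sub>0"
    then obtain r where r: "w = r *\<^sub>R a k\<^sub>0"
      by blast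
    with w have "w \<in> (\<lambda>l. axis i 1 - axis l 1) ` {l. l \<noteq> i \<and> l \<noteq> j}"
      unfolding A_def by blast
    then obtain l where l: "l \<noteq> i" "l \<noteq> j" "w = axis i 1 - axis l 1"
      by auto
    then have "w $ l = - 1" "a k\<^sub>0 $ l = 0"
      by (simp_all add: axis_def ak0)
    then show False
      using r by simp
  qed
  ultimately obtain v where v: "a k\<^sub>0 \<bullet> v = 0" "\<And>w. w \<in> A \<Longrightarrow> w \<bullet> v \<noteq> 0"
    using exists_orthogonal_generic by blast
  have vij: "v $ j = v $ i"
    using v(1) by (simp add: ak0 inner_diff_left inner_axis')
  have ff: "far_facet {1..K} a k\<^sub>0 v"
  proof
    show "a k\<^sub>0 \<noteq> 0" "k\<^sub>0 \<in> {1..K}"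
      using nz k0 by auto
    show "\<exists>r. a k = r *\<^sub>R a k\<^sub>0" if "k \<in> {1..K}" "a k \<bullet> v = 0" for k
      using v(2)[of "a k"] that unfolding A_def by blast
  qed (use v in auto)
  interpret far_facet "{1..K}" a b k\<^sub>0 v by fact
  have distinct: "v $ l \<noteq> v $ i" if "l \<noteq> i" "l \<noteq> j" for l
  proof -
    have "axis i 1 - axis l 1 \<in> A"
      using that unfolding A_def by auto
    from v(2)[OF this] show ?thesis
      by (simp add: inner_diff_left inner_axis')
  qed
  have slab_outer: "slab 1 = {\<beta>..}"
  proof (intro equalityI subsetI)
    fix t assume "t \<in> {\<beta>..}"
    then have t: "\<beta> \<le> t" by simp
    have "0 \<le> (r * t - b k) * (r * \<beta> - b k)" if k: "k \<in> {1..K}" "a k = r *\<^sub>R \<nu>" for k r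
    proof (cases "0 \<le> r")
      case True
      then have "b k \<le> r * \<beta>" "r * \<beta> \<le> r * t"
        using outer[OF k] t by (auto intro: mult_left_mono)
      then show ?thesis
        by simp
    next
      case False
      then have "r * \<beta> \<le> b k" "r * t \<le> r * \<beta>"
        using outer[OF k] t by (auto intro: mult_left_mono_neg)
      then show ?thesis
        by (intro mult_nonpos_nonpos) auto
    qed
    moreover have "0 \<le> 1 * (t - \<beta>)"
      using t by simp
    ultimately show "t \<in> slab 1"
      unfolding slab_def by blast
  qed (use slab_side[of _ 1] in auto)
  have \<nu>i: "\<nu> $ i = 1" and \<nu>j: "\<nu> $ j = - 1" and \<nu>l: "\<And>l. l \<noteq> i \<Longrightarrow> l \<noteq> j \<Longrightarrow> \<nu> $ l = 0"
    using ij by (simp_all add: ak0 axis_def)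
  have \<nu>x: "\<nu> \<bullet> x = x $ i - x $ j" for x
    by (simp add: ak0 inner_diff_left inner_axis')
  have \<nu>\<nu>: "\<nu> \<bullet> \<nu> = 2"
    unfolding \<nu>x \<nu>i \<nu>j by simp
  \<comment> \<open>In the limit \<open>cp \<eta> z\<close> is the difference of the projected
    coordinates \<open>i\<close> and \<open>j\<close>, while their sum stays
    \<open>z $ i + z $ j\<close>. \<open>F x z\<close> is the joint contribution of the two
    coordinates when the difference is \<open>x\<close>.\<close>
  define cp where "cp \<eta> z = closest_point (slab \<eta>) (\<beta> + (z $ i - z $ j))" for \<eta> and z :: "real ^ 'n"
  define F where "F x z = max 0 ((z $ i + z $ j) / 2 + x / 2) + max 0 ((z $ i + z $ j) / 2 - x / 2)"
    for x and z :: "real ^ 'n"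
  have sp: "slab_point \<eta> (base + z) $ i = (z $ i + z $ j) / 2 + cp \<eta> z / 2"
      "slab_point \<eta> (base + z) $ j = (z $ i + z $ j) / 2 - cp \<eta> z / 2" for \<eta> z
  proof -
    have t: "\<nu> \<bullet> (base + z) = \<beta> + (z $ i - z $ j)"
      using inner_base \<nu>x by (simp add: inner_add_right)
    have base: "base $ i = \<beta> / 2" "base $ j = - \<beta> / 2"
      by (simp_all add: base_def \<nu>\<nu> \<nu>i \<nu>j)
    show "slab_point \<eta> (base + z) $ i = (z $ i + z $ j) / 2 + cp \<eta> z / 2"
      "slab_point \<eta> (base + z) $ j = (z $ i + z $ j) / 2 - cp \<eta> z / 2"
      unfolding slab_point_def cp_def t \<nu>\<nu> vector_add_component vector_scaleR_component \<nu>i \<nu>j base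
      by (simp_all add: field_simps)
  qed
  \<comment> \<open>With threshold \<open>v $ i\<close> the coordinates \<open>i\<close> and
    \<open>j\<close> keep a genuine hinge. All others are unmoved by both projections and cancel.
    The sign -1 stands for a mean on the inner side.\<close>
  have gap: "(\<Sum>l\<in>UNIV. hinge_limit (v $ l - v $ i) (slab_point (- 1) (base + z) $ l) -
      hinge_limit (v $ l - v $ i) (slab_point (- (- 1)) (base + z) $ l)) = F (cp (- 1) z) z - F (cp 1 z) z" for z
  proof -
    let ?g = "\<lambda>l. hinge_limit (v $ l - v $ i) (slab_point (- 1) (base + z) $ l) -
      hinge_limit (v $ l - v $ i) (slab_point (- (- 1)) (base + z) $ l)"
    have "?g l = 0" if "l \<in> UNIV - {i, j}" for l
    proof -
      have "slab_point (- 1) (base + z) $ l = slab_point 1 (base + z) $ l"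
        using arg_cong[OF slab_point_component_diff[of "- 1" "base + z" 1], of "\<lambda>w. w $ l"] \<nu>l[of l] that by simp
      then show ?thesis
        by simp
    qed
    then have "sum ?g UNIV = sum ?g {i, j}"
      by (intro sum.mono_neutral_right) auto
    also have "\<dots> = F (cp (- 1) z) z - F (cp 1 z) z"
      using ij by (simp add: hinge_limit_def vij sp F_def del: One_nat_def)
    finally show ?thesis .
  qed
  define \<gamma> where "\<gamma> = distr (M 0) borel (X 0)"
  note limit = truthful_limit[OF \<sigma> nm lkp tr H nz ff, where c = "v $ i" and \<eta> = "- 1",
      unfolded gap, folded \<gamma>_def, simplified]
  note \<gamma> = noise_law[OF \<sigma> nm[of 0], folded \<gamma>_def]
  define F1 where "F1 z = F (\<beta> + max 0 (z $ i - z $ j)) z" for z :: "real ^ 'n"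
  \<comment> \<open>The outer contribution with the noise in \<open>i\<close> and \<open>j\<close>
    exchanged. The pointwise comparison of \<open>F1\<close> with the inner contribution can fail
    where the inner projection lies below \<open>-\<beta>\<close>; with the noise exchanged it holds
    everywhere.\<close>
  define F1' where "F1' z = F (\<beta> + max 0 (z $ j - z $ i)) z" for z :: "real ^ 'n"
  have cp1: "F (cp 1 z) z = F1 z" for z
  proof -
    have "cp 1 z = \<beta> + max 0 (z $ i - z $ j)"
      unfolding cp_def slab_outer closest_point_atLeast by (simp add: max_def)
    then show ?thesis
      by (simp add: F1_def)
  qed
  have cont: "continuous_on UNIV F1" "continuous_on UNIV F1'"
    unfolding F1_def[abs_def] F1'_def[abs_def] F_def by (intro continuous_intros; simp)+
  have meas: "F1 \<in> borel_measurable borel" "F1' \<in> borel_measurable borel"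
    using cont by (simp_all add: borel_measurable_continuous_onI)
  have bound: "\<bar>F1 z\<bar> \<le> 4 * (\<beta> + norm z)" "\<bar>F1' z\<bar> \<le> 4 * (\<beta> + norm z)" for z
  proof -
    have z: "\<bar>z $ i\<bar> \<le> norm z" "\<bar>z $ j\<bar> \<le> norm z"
      by (rule component_le_norm_cart)+
    have F_bound: "0 \<le> F x z \<and> F x z \<le> 2 * norm z + x" if "0 \<le> x" for x
    proof -
      have "max 0 ((z $ i + z $ j) / 2 + x / 2) \<le> norm z + x / 2"
        "max 0 ((z $ i + z $ j) / 2 - x / 2) \<le> norm z + x / 2"
        using z that by (auto intro!: max.boundedI)
      then show ?thesis
        unfolding F_def by (intro conjI; linarith)
    qed
    have "\<bar>F x z\<bar> \<le> 4 * (\<beta> + norm z)" if "0 \<le> x" "x \<le> \<beta> + 2 * norm z" for x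
    proof -
      have "0 \<le> F x z" "F x z \<le> 2 * norm z + x"
        using F_bound[OF that(1)] by auto
      then show ?thesis
        using that \<beta> norm_ge_zero[of z] unfolding distrib_left by linarith
    qed
    moreover have "max 0 (z $ i - z $ j) \<le> 2 * norm z" "max 0 (z $ j - z $ i) \<le> 2 * norm z"
      using z by (auto intro!: max.boundedI)
    ultimately show "\<bar>F1 z\<bar> \<le> 4 * (\<beta> + norm z)" "\<bar>F1' z\<bar> \<le> 4 * (\<beta> + norm z)"
      unfolding F1_def F1'_def using \<beta> by (auto simp: add_nonneg_nonneg)
  qed
  have dom: "integrable \<gamma> (\<lambda>z. 4 * (\<beta> + norm z))"
    using integrable_affine_norm[OF \<gamma>(1,3), of 4 \<beta> 0] by (simp only: add_0_right)
  have int1: "integrable \<gamma> F1"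
    by (rule Bochner_Integration.integrable_bound[OF dom])
      (use meas \<gamma>(2) bound \<beta> in \<open>auto simp: abs_of_nonneg cong: measurable_cong_sets\<close>)
  have int1': "integrable \<gamma> F1'"
    by (rule Bochner_Integration.integrable_bound[OF dom])
      (use meas \<gamma>(2) bound \<beta> in \<open>auto simp: abs_of_nonneg cong: measurable_cong_sets\<close>)
  have swap: "integral\<^sup>L \<gamma> F1 = integral\<^sup>L \<gamma> F1'"
  proof -
    let ?p = "Transposition.transpose i j"
    let ?Y = "\<lambda>\<omega>. \<chi> l. X 0 \<omega> $ ?p l"
    have Y: "normal_model \<sigma> 0 (M 0) ?Y"
      by (rule normal_model_permute[OF _ nm]) simp
    have "\<gamma> = distr (M 0) borel ?Y"
      unfolding \<gamma>_def by (rule normal_model_distr_unique[OF nm Y])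
    then have "integral\<^sup>L \<gamma> F1 = (\<integral>\<omega>. F1 (?Y \<omega>) \<partial>M 0)"
      using normal_model_measurable[OF Y] meas by (simp add: integral_distr)
    also have "\<dots> = (\<integral>\<omega>. F1' (X 0 \<omega>) \<partial>M 0)"
      by (simp add: F1_def F1'_def F_def add.commute)
    also have "\<dots> = integral\<^sup>L \<gamma> F1'"
      unfolding \<gamma>_def using normal_model_measurable[OF nm] meas by (simp add: integral_distr)
    finally show ?thesis .
  qed
  \<comment> \<open>By exchangeability \<open>D\<close> has the integral of the outer minus the
    inner contribution, which truthfulness makes nonpositive. Yet \<open>D\<close> is nonnegative,
    and positive on an open set.\<close>
  define D where "D z = F1' z - F (cp (- 1) z) z" for z
  have intD: "integrable \<gamma> D" and D_le: "integral\<^sup>L \<gamma> D \<le> 0"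
  proof -
    have lim: "integrable \<gamma> (\<lambda>z. F (cp (- 1) z) z - F1 z)" "0 \<le> integral\<^sup>L \<gamma> (\<lambda>z. F (cp (- 1) z) z - F1 z)"
      using limit unfolding cp1 .
    have D: "D = (\<lambda>z. (F1' z - F1 z) - (F (cp (- 1) z) z - F1 z))"
      by (auto simp: D_def)
    have diff: "integrable \<gamma> (\<lambda>z. F1' z - F1 z)"
      using int1 int1' by simp
    show "integrable \<gamma> D"
      unfolding D by (rule Bochner_Integration.integrable_diff[OF diff lim(1)])
    have "integral\<^sup>L \<gamma> D = integral\<^sup>L \<gamma> (\<lambda>z. F1' z - F1 z) - integral\<^sup>L \<gamma> (\<lambda>z. F (cp (- 1) z) z - F1 z)"
      unfolding D by (rule Bochner_Integration.integral_diff[OF diff lim(1)])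
    moreover have "integral\<^sup>L \<gamma> (\<lambda>z. F1' z - F1 z) = 0"
      using int1 int1' swap by simp
    ultimately show "integral\<^sup>L \<gamma> D \<le> 0"
      using lim(2) by simp
  qed
  \<comment> \<open>If \<open>z $ j \<le> z $ i\<close>, the inner projection is \<beta> itself.
    Otherwise it lies between \<open>\<beta> + (z $ i - z $ j)\<close> and \<beta>, and the bound on
    the modulus is strict because \<beta> is positive.\<close>
  have cp_le: "\<bar>cp (- 1) z\<bar> \<le> \<beta> + max 0 (z $ j - z $ i)"
      "z $ i < z $ j \<Longrightarrow> \<bar>cp (- 1) z\<bar> < \<beta> + (z $ j - z $ i)" for z
  proof -
    consider "z $ j \<le> z $ i" | "z $ i < z $ j" by linarith
    then have "\<bar>cp (- 1) z\<bar> \<le> \<beta> + max 0 (z $ j - z $ i) \<and>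
        (z $ i < z $ j \<longrightarrow> \<bar>cp (- 1) z\<bar> < \<beta> + (z $ j - z $ i))"
    proof cases
      case 1
      have "\<beta> \<le> cp (- 1) z"
        unfolding cp_def using 1
        by (intro closest_point_real_between(1)[OF closed_slab convex_slab beta_in_slab]) simp
      moreover have "cp (- 1) z \<le> \<beta>"
        unfolding cp_def using slab_side[OF closest_point_in_set[OF closed_slab], of "- 1"] beta_in_slab by fastforce
      ultimately show ?thesis
        using 1 \<beta> by simp
    next
      case 2
      have "cp (- 1) z \<le> \<beta>" "\<beta> + (z $ i - z $ j) \<le> cp (- 1) z"
        unfolding cp_def using 2
        by (intro closest_point_real_between'[OF closed_slab convex_slab beta_in_slab]; simp)+
      then show ?thesis
        using 2 \<beta> by auto
    qed
    then show "\<bar>cp (- 1) z\<bar> \<le> \<beta> + max 0 (z $ j - z $ i)"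
      "z $ i < z $ j \<Longrightarrow> \<bar>cp (- 1) z\<bar> < \<beta> + (z $ j - z $ i)"
      by blast+
  qed
  have "0 < integral\<^sup>L (distr (M 0) borel (X 0)) D"
  proof (rule integral_pos_of_open[OF \<sigma> nm])
    \<comment> \<open>The first condition makes \<open>cp_le\<close> strict. The second leaves the
      range where the pair of hinges is constant.\<close>
    let ?O = "{z. z $ i < z $ j} \<inter> {z :: real ^ 'n. \<bar>z $ i + z $ j\<bar> < \<beta>}"
    show "integrable (distr (M 0) borel (X 0)) D"
      using intD by (simp add: \<gamma>_def)
    show "0 \<le> D z" for z
      using hinge_pair_mono[OF cp_le(1)] by (simp add: D_def F1'_def F_def)
    show "open ?O"
      by (intro open_Int open_Collect_less continuous_intros)
    show "axis j 1 - axis i 1 \<in> ?O"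
      using ij \<beta> by (simp add: axis_def)
    show "0 < D z" if "z \<in> ?O" for z
      using that cp_le(2)[of z] by (auto simp: D_def F1'_def F_def intro!: hinge_pair_strict_mono)
  qed
  then show False
    using D_le by (simp add: \<gamma>_def)
qed

section \<open>Reduction to the outermost parallel hyperplane\<close>

theorem proposition1:
  fixes \<sigma> :: real
    and M :: "real ^ 'n \<Rightarrow> 'w measure"
    and X :: "real ^ 'n \<Rightarrow> 'w \<Rightarrow> real ^ 'n"
    and \<S> :: "(real ^ 'n) set set"
    and K :: nat
    and H :: "nat \<Rightarrow> (real ^ 'n) set"
  assumes "CARD('n) \<ge> 2"
    and "\<sigma> > 0"
    and "\<And>\<mu>. normal_model \<sigma> \<mu> (M \<mu>) (X \<mu>)"
    and "linear_knowledge_partition \<S> K H"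
    and "truthful M X \<S>"
  shows "\<forall>k\<in>{1..K}. \<exists>i j. i \<noteq> j \<and> H k = {x. x $ i - x $ j = 0}"
proof
  fix k\<^sub>0 assume k0: "k\<^sub>0 \<in> {1..K}"
  have "\<forall>k\<in>{1..K}. \<exists>ab. fst ab \<noteq> 0 \<and> H k = {x. fst ab \<bullet> x = snd ab}"
    using assms(4) unfolding linear_knowledge_partition_def affine_hyperplane_def by fastforce
  then obtain ab where ab: "\<And>k. k \<in> {1..K} \<Longrightarrow> fst (ab k) \<noteq> 0 \<and> H k = {x. fst (ab k) \<bullet> x = snd (ab k)}"
    by metis
  define a where "a = (\<lambda>k. fst (ab k))"
  define b where "b = (\<lambda>k. snd (ab k))"
  have nz: "a k \<noteq> 0" and H: "H k = {x. a k \<bullet> x = b k}" if "k \<in> {1..K}" for k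
    using ab[OF that] by (simp_all add: a_def b_def)
  obtain i j r where ij: "i \<noteq> j" and r: "a k\<^sub>0 = r *\<^sub>R (axis i 1 - axis j 1)"
    using truthful_normal_is_difference[OF assms(2-5) H nz k0] by blast
  let ?u = "axis i 1 - axis j 1 :: real ^ 'n"
  have "r \<noteq> 0"
    using nz[OF k0] r by auto
  have ui: "?u $ i = 1"
    using ij by (simp add: axis_def)
  \<comment> \<open>\<open>P\<close> indexes the hyperplanes parallel to \<open>?u\<close>, and
    \<open>f\<close> is the modulus of their offsets once the normal is scaled to \<open>?u\<close>.
    It suffices that the largest value, attained at \<open>k1\<close>, is zero.\<close>
  define P where "P = {k \<in> {1..K}. \<exists>r. a k = r *\<^sub>R ?u}"
  define f where "f k = \<bar>b k / (a k $ i)\<bar>" for k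
  have "k\<^sub>0 \<in> P" "finite P"
    using k0 r by (auto simp: P_def)
  then have "Max (f ` P) \<in> f ` P"
    by (intro Max_in) auto
  then obtain k1 where k1: "k1 \<in> P" "f k1 = Max (f ` P)"
    by auto
  have f_max: "f k \<le> f k1" if "k \<in> P" for k
    unfolding k1(2) using that \<open>finite P\<close> by (intro Max_ge) auto
  obtain s where s: "a k1 = s *\<^sub>R ?u" "k1 \<in> {1..K}"
    using k1(1) unfolding P_def by blast
  then have "s \<noteq> 0"
    using nz[of k1] by auto
  have sk: "a k1 $ i = s"
    using s ui by simp
  have "f k1 = 0"
  proof (rule ccontr)
    assume "f k1 \<noteq> 0"
    then have pos: "0 < f k1"
      unfolding f_def by simp
    \<comment> \<open>The sign that makes the offset of \<open>k1\<close> positive with respect to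
      the normal \<open>\<epsilon> *\<^sub>R ?u\<close>. Replacing the representation at
      \<open>k1\<close> alone leaves all hyperplanes unchanged as sets.\<close>
    define \<epsilon> where "\<epsilon> = (if 0 < b k1 / s then 1 else - 1 :: real)"
    have \<epsilon>: "\<epsilon> * (b k1 / s) = f k1" "\<epsilon> * \<epsilon> = 1" "\<bar>\<epsilon>\<bar> = 1"
      unfolding \<epsilon>_def f_def sk by (auto simp: abs_if simp del: abs_divide)
    define a' where "a' = a(k1 := \<epsilon> *\<^sub>R ?u)"
    define b' where "b' = b(k1 := f k1)"
    have H': "H k = {x. a' k \<bullet> x = b' k}" if "k \<in> {1..K}" for k
    proof (cases "k = k1")
      case True
      have "a k1 \<bullet> x = b k1 \<longleftrightarrow> \<epsilon> *\<^sub>R ?u \<bullet> x = f k1" for x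
      proof -
        have "a k1 \<bullet> x = b k1 \<longleftrightarrow> ?u \<bullet> x = b k1 / s"
          using \<open>s \<noteq> 0\<close> unfolding s(1) inner_scaleR_left by (simp add: eq_divide_eq mult.commute)
        also have "\<dots> \<longleftrightarrow> \<epsilon> * (?u \<bullet> x) = \<epsilon> * (b k1 / s)"
          using \<epsilon>(3) by (simp only: mult_cancel_left) auto
        finally show ?thesis
          unfolding \<epsilon>(1) by simp
      qed
      then show ?thesis
        using H[OF that] True by (simp add: a'_def b'_def)
    next
      case False
      then show ?thesis
        using H[OF that] by (simp add: a'_def b'_def)
    qed
    have "?u \<noteq> 0"
      using ui by (metis zero_index zero_neq_one)
    have nz': "a' k \<noteq> 0" if "k \<in> {1..K}" for k
      using nz[OF that] \<open>?u \<noteq> 0\<close> \<epsilon>(2) by (auto simp: a'_def)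
    have outer: "\<bar>b' k\<bar> \<le> \<bar>t\<bar> * b' k1" if k: "k \<in> {1..K}" and t: "a' k = t *\<^sub>R a' k1" for k t
    proof (cases "k = k1")
      case True
      then have "t = 1"
        using t nz'[OF k] by (metis scaleR_cancel_right scaleR_one)
      then show ?thesis
        using True pos by (simp add: b'_def)
    next
      case False
      then have at: "a k = (t * \<epsilon>) *\<^sub>R ?u"
        using t by (simp add: a'_def)
      then have "k \<in> P" "a k $ i = t * \<epsilon>" "t \<noteq> 0"
        using k ui nz[OF k] by (auto simp: P_def)
      then have "\<bar>b k / (t * \<epsilon>)\<bar> \<le> f k1"
        using f_max[of k] by (simp add: f_def)
      then show ?thesis
        using False \<open>t \<noteq> 0\<close> \<epsilon>(3) by (simp add: b'_def abs_mult abs_divide field_simps)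
    qed
    \<comment> \<open>A negative sign amounts to exchanging the roles of \<open>i\<close> and
      \<open>j\<close>.\<close>
    have "b' k1 \<le> 0"
    proof (cases "\<epsilon> = 1")
      case True
      then show ?thesis
        by (intro truthful_no_outermost_offset[OF assms(2-5) H' nz' s(2) ij _ outer]) (simp_all add: a'_def)
    next
      case False
      then have "\<epsilon> = - 1"
        by (simp add: \<epsilon>_def split: if_splits)
      then show ?thesis
        by (intro truthful_no_outermost_offset[OF assms(2-5) H' nz' s(2) ij[symmetric] _ outer]) (simp_all add: a'_def)
    qed
    then show False
      using pos by (simp add: b'_def)
  qed
  then have "f k\<^sub>0 = 0"
    using f_max[OF \<open>k\<^sub>0 \<in> P\<close>] abs_ge_zero[of "b k\<^sub>0 / a k\<^sub>0 $ i"] unfolding f_def by linarith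
  then have "b k\<^sub>0 = 0"
    using r ui \<open>r \<noteq> 0\<close> by (simp add: f_def)
  then have "H k\<^sub>0 = {x. x $ i - x $ j = 0}"
    using H[OF k0] r \<open>r \<noteq> 0\<close> by (simp add: inner_diff_left inner_axis')
  \<comment> \<open>The equation is symmetric in the two indices, so an unordered pair of distinct
    indices expresses the claim.\<close>
  then show "\<exists>i j. i \<noteq> j \<and> H k\<^sub>0 = {x. x $ i - x $ j = 0}"
    using ij by blast
qed

end
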